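(* Let $f(q)=\sum_{n\ge 0}c_nq^n$ be a power series, convergent for $|q|<1$, whose coefficients $c_n$ are non-negative real numbers. Suppose that for some positive integer $m$ the following hold: (i) $c_{n+m}\ge c_n$ for all $n\ge 0$; and (ii) there exist constants $\gamma\in\mathbb{R}$ and $\alpha,\beta,\rho\in\mathbb{R}_{+}$ (positive reals) such that $$f(e^{-z})\sim \alpha z^{\gamma}\exp\left(\beta z^{-\rho}/\rho\right)$$ and, for every integer $h$ with $1\le h<m$, $$f(e^{-z}e^{2\pi \mathrm{i} h/m})=o\left(f(e^{-z})\right),$$ when $z\to 0$ in every fixed Stolz angle $|\arg (z)|\le \Delta$ $(0<\Delta<\pi/2)$. Then, as $n\to \infty$, $$c_n\sim \frac{\alpha\, \beta^{\frac{1+2\gamma}{2(1+\rho)}}}{\sqrt{2\pi(1+\rho)}}\;n^{-\frac{1+2\gamma}{2(1+\rho)}-\frac{1}{2}}\exp\left((1+1/\rho)\,\beta^{1/(1+\rho)}\, n^{\rho/(1+\rho)}\right).$$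
   Context: "When $z\to 0$ in every fixed Stolz angle $|\arg(z)|\le\Delta$ $(0<\Delta<\pi/2)$" means: for each fixed $\Delta\in(0,\pi/2)$, the asymptotic relation holds as the complex variable $z\neq 0$ tends to $0$ within $\{z:|\arg z|\le\Delta\}$. Powers of $z$ are taken with the principal branch. *)

theory Defs
  imports "HOL-Analysis.Analysis" "HOL-Library.Landau_Symbols"
begin

end

(* Fix N and let x solve N x = beta x^(-rho).  Put mass c_n e^(-nx), over n congruent to N mod m, at the
   point (n - N) x.  Multiplying by the Fejer kernel and taking Fourier transforms turns these masses
   into integrals of f over the compact segment z = x (1 - i s), |s - t| <= 1, which lies in a fixed
   Stolz angle; the root of unity filter together with the minor arc hypothesis leaves only the main
   term.  Laplace's argument gives the limit of the transforms, and Levy's continuity theorem shows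
   that, suitably normalised, the masses converge vaguely near 0 to Lebesgue measure.  The resolution
   in n is thus delta / x for every fixed delta, on which e^(-nx) varies by a bounded factor only, so the
   monotonicity of c along residue classes, applied on the windows [0, delta] and [-delta, 0], recovers c_N. *)

theory Submission
  imports Defs "HOL-Probability.Probability" "HOL-Real_Asymp.Real_Asymp"
begin

section \<open>The Fejer kernel\<close>

text \<open>The hypotheses say nothing about f outside Stolz angles; there only the trivial bound
  |f(e^(-z))| <= f(e^(-x)) with x = Re z is left. In a Cauchy integral for c_N that bound is too
  weak, since the main term carries the additional small factor 1 / sqrt (N x), the width of the
  Gaussian peak. Test functions of compactly supported spectrum avoid these z, at the price of
  seeing only averages of c over windows of length delta / x. Such windows are far shorter than the
  natural spread sqrt (N x) / x of the masses c_n e^(-nx), which is why the limit is flat: it is a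
  wide Gaussian seen from close up. The limiting transform L * tri t, with L = sqrt (2 pi / (1 +
  rho)), belongs to L / (2 pi) times the Fejer kernel, and L / (2 pi) = 1 / sqrt (2 pi (1 + rho))
  becomes the prefactor of the theorem. The equation for x may ignore the factor z^gamma: relative
  to its value at x it is (1 - i s)^gamma, which tends to 1 on the scale s ~ 1 / sqrt (N x).\<close>

definition tri :: "real \<Rightarrow> real" where
  "tri s = max 0 (1 - \<bar>s\<bar>)"

definition fejer :: "real \<Rightarrow> real" where
  "fejer v = (sinc (v / 2))\<^sup>2"

lemma tri_bounds [simp]: "0 \<le> tri s" "tri s \<le> 1"
  by (auto simp: tri_def)

lemma tri_0 [simp]: "tri 0 = 1"
  by (simp add: tri_def)

lemma isCont_tri: "isCont tri s"
  unfolding tri_def by (intro continuous_intros)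

lemma measurable_tri [measurable]: "tri \<in> borel_measurable borel"
  unfolding tri_def by measurable

lemma fejer_nonneg [simp]: "0 \<le> fejer v"
  by (simp add: fejer_def)

lemma fejer_0 [simp]: "fejer 0 = 1"
  by (simp add: fejer_def)

lemma fejer_minus [simp]: "fejer (- v) = fejer v"
  by (simp add: fejer_def)

lemma isCont_fejer: "isCont fejer v"
proof -
  have "isCont (\<lambda>v. sinc (v / 2)) v"
    by (rule isCont_o2[OF _ isCont_sinc]) (intro continuous_intros, simp)
  then show ?thesis
    unfolding fejer_def by (intro continuous_intros)
qed

lemma measurable_fejer [measurable]: "fejer \<in> borel_measurable borel"
  unfolding fejer_def by measurable

lemma fejer_eq: "fejer v = 2 * (1 - cos v) / v\<^sup>2" if "v \<noteq> 0"
proof -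
  have "cos v = 1 - 2 * (sin (v / 2))\<^sup>2"
    using cos_double_sin[of "v / 2"] by simp
  then show ?thesis
    using that by (simp add: fejer_def power_divide)
qed

lemma fejer_pos: "fejer v > 0" if "\<bar>v\<bar> \<le> 1"
proof (cases "v = 0")
  case False
  then have "cos \<bar>v\<bar> < cos 0"
    using that pi_gt3 by (intro cos_monotone_0_pi) auto
  with False show ?thesis
    by (simp add: fejer_eq)
qed simp

lemma has_bochner_integral_tri_iexp:
  "has_bochner_integral lborel (\<lambda>s. tri s *\<^sub>R iexp (s * v)) (complex_of_real (fejer v))"
proof -
  \<comment> \<open>\<open>F\<close> and \<open>G\<close> come from integrating (1 - s) e^(ivs) and
    (1 + s) e^(ivs) by parts, with \<open>k\<close> the reciprocal of iv. For v = 0 this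
    \<open>k\<close> is 1/0 = 0, so that case has polynomial antiderivatives of its own.\<close>
  define k where "k = 1 / (\<i> * complex_of_real v)"
  have k: "\<i> * complex_of_real v * k = 1" if "v \<noteq> 0"
    using that by (simp add: k_def)
  define F G where
    "F = (\<lambda>s. if v = 0 then complex_of_real (s - s\<^sup>2 / 2)
      else (1 - of_real s) * iexp (v * s) * k + iexp (v * s) * k\<^sup>2)" and
    "G = (\<lambda>s. if v = 0 then complex_of_real (s + s\<^sup>2 / 2)
      else (1 + of_real s) * iexp (v * s) * k - iexp (v * s) * k\<^sup>2)"
  have F: "(F has_vector_derivative (1 - s) *\<^sub>R iexp (s * v)) (at s within A)" for s A
  proof (cases "v = 0")
    case True
    have "((\<lambda>z. z - z\<^sup>2 / 2) has_field_derivative 1 - complex_of_real s) (at (of_real s))"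
      by (auto intro!: derivative_eq_intros)
    from has_vector_derivative_real_field[OF this] show ?thesis
      using True by (simp add: F_def scaleR_conv_of_real)
  next
    case False
    have "((\<lambda>z. (1 - z) * exp (\<i> * v * z) * k + exp (\<i> * v * z) * k\<^sup>2)
        has_field_derivative (0 - 1) * exp (\<i> * v * s) * k + (1 - s) * ((\<i> * v) * exp (\<i> * v * s)) * k
           + (\<i> * v) * exp (\<i> * v * s) * k\<^sup>2) (at (complex_of_real s))"
      by (auto intro!: derivative_eq_intros simp: algebra_simps)
    also have "(0 - 1) * exp (\<i> * v * s) * k + (1 - s) * ((\<i> * v) * exp (\<i> * v * s)) * k
           + (\<i> * v) * exp (\<i> * v * s) * k\<^sup>2 = (1 - s) * exp (\<i> * v * s)"
      using k[OF False] by algebra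
    finally have D: "((\<lambda>z. (1 - z) * exp (\<i> * v * z) * k + exp (\<i> * v * z) * k\<^sup>2) has_field_derivative
        (1 - s) * exp (\<i> * v * s)) (at (complex_of_real s))" .
    show ?thesis
      using has_vector_derivative_real_field[OF D] False by (simp add: F_def scaleR_conv_of_real mult_ac)
  qed
  have G: "(G has_vector_derivative (1 + s) *\<^sub>R iexp (s * v)) (at s within A)" for s A
  proof (cases "v = 0")
    case True
    have "((\<lambda>z. z + z\<^sup>2 / 2) has_field_derivative 1 + complex_of_real s) (at (of_real s))"
      by (auto intro!: derivative_eq_intros)
    from has_vector_derivative_real_field[OF this] show ?thesis
      using True by (simp add: G_def scaleR_conv_of_real)
  next
    case False
    have "((\<lambda>z. (1 + z) * exp (\<i> * v * z) * k - exp (\<i> * v * z) * k\<^sup>2)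
        has_field_derivative (0 + 1) * exp (\<i> * v * s) * k + (1 + s) * ((\<i> * v) * exp (\<i> * v * s)) * k
           - (\<i> * v) * exp (\<i> * v * s) * k\<^sup>2) (at (complex_of_real s))"
      by (auto intro!: derivative_eq_intros simp: algebra_simps)
    also have "(0 + 1) * exp (\<i> * v * s) * k + (1 + s) * ((\<i> * v) * exp (\<i> * v * s)) * k
           - (\<i> * v) * exp (\<i> * v * s) * k\<^sup>2 = (1 + s) * exp (\<i> * v * s)"
      using k[OF False] by algebra
    finally have D: "((\<lambda>z. (1 + z) * exp (\<i> * v * z) * k - exp (\<i> * v * z) * k\<^sup>2) has_field_derivative
        (1 + s) * exp (\<i> * v * s)) (at (complex_of_real s))" .
    show ?thesis
      using has_vector_derivative_real_field[OF D] False by (simp add: G_def scaleR_conv_of_real mult_ac)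
  qed
  have "has_bochner_integral lborel
     (\<lambda>s. indicator {0..1} s *\<^sub>R ((1 - s) *\<^sub>R iexp (s * v)) + indicator {-1..0} s *\<^sub>R ((1 + s) *\<^sub>R iexp (s * v)))
     (F 1 - F 0 + (G 0 - G (- 1)))"
    by (intro has_bochner_integral_add has_bochner_integral_FTC_Icc F G continuous_intros) auto
  moreover have "F 1 - F 0 + (G 0 - G (- 1)) = fejer v"
  proof (cases "v = 0")
    case False
    then show ?thesis
      by (simp add: F_def G_def fejer_eq k_def cos_exp_eq power2_eq_square field_simps flip: cos_of_real)
  qed (simp add: F_def G_def)
  \<comment> \<open>The two closed intervals share the point 0, where the sum is 2 instead of 1;
    hence equality only almost everywhere.\<close>
  moreover have "AE s in lborel. indicator {0..1} s *\<^sub>R ((1 - s) *\<^sub>R iexp (s * v))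
      + indicator {-1..0} s *\<^sub>R ((1 + s) *\<^sub>R iexp (s * v)) = tri s *\<^sub>R iexp (s * v)"
    using AE_lborel_singleton[of 0]
    by eventually_elim (auto simp: tri_def indicator_def)
  ultimately show ?thesis
    by (subst has_bochner_integral_cong_AE[symmetric]) auto
qed

text \<open>The triangle \<open>tri\<close> is half a second difference of absolute values, so
  representing \<open>\<bar>a\<bar>\<close> by an absolutely convergent integral gives the transform
  of the Fejer kernel without Fourier inversion. Integration by parts reduces the case a = 1 to the
  Dirichlet integral, and scaling does the rest.\<close>

lemma has_bochner_integral_one_minus_cos:
  "has_bochner_integral lborel (\<lambda>v. (1 - cos (a * v)) / v\<^sup>2) (pi * \<bar>a\<bar>)"
proof -
  have base: "has_bochner_integral lborel (\<lambda>v::real. (1 - cos v) / v\<^sup>2) pi"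
  proof -
    define H where "H = (\<lambda>v::real. Si v - (1 - cos v) / v)"
    have H: "(H has_real_derivative (1 - cos v) / v\<^sup>2) (at v)" if "v > 0" for v
      unfolding H_def using that
      by (auto intro!: derivative_eq_intros DERIV_Si simp: field_simps power2_eq_square)
    \<comment> \<open>The boundary term (1 - cos v) / v equals sin (v/2) sinc (v/2), a form that is
      continuous at 0.\<close>
    have "((\<lambda>v. Si v - sin (v / 2) * sinc (v / 2)) \<longlongrightarrow> Si 0 - sin (0 / 2) * sinc (0 / 2)) (at_right 0)"
      by (intro tendsto_intros isCont_tendsto_compose[OF isCont_Si] isCont_tendsto_compose[OF isCont_sinc]) auto
    moreover have "eventually (\<lambda>v. Si v - sin (v / 2) * sinc (v / 2) = H v) (at_right 0)"
      using eventually_at_right_less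
    proof eventually_elim
      case (elim v)
      have "cos v = 1 - 2 * (sin (v / 2))\<^sup>2"
        using cos_double_sin[of "v / 2"] by simp
      with elim show ?case by (simp add: H_def power2_eq_square)
    qed
    ultimately have H0: "(H \<longlongrightarrow> 0) (at_right 0)"
      by (auto elim!: Lim_transform_eventually simp: Si_def zero_ereal_def)
    have "((\<lambda>v::real. (1 - cos v) / v) \<longlongrightarrow> 0) at_top"
    proof (rule Lim_null_comparison)
      show "eventually (\<lambda>v::real. norm ((1 - cos v) / v) \<le> 2 / v) at_top"
        using eventually_gt_at_top[of 0]
      proof eventually_elim
        case (elim v)
        then show ?case using cos_le_one[of v] cos_ge_minus_one[of v] by (simp add: divide_right_mono)
      qed
      show "((\<lambda>v::real. 2 / v) \<longlongrightarrow> 0) at_top"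
        by real_asymp
    qed
    then have H1: "(H \<longlongrightarrow> pi / 2) at_top"
      unfolding H_def using tendsto_diff[OF Si_at_top] by fastforce
    have H0': "((H \<circ> real_of_ereal) \<longlongrightarrow> 0) (at_right 0)"
      using H0 by (simp only: zero_ereal_def ereal_tendsto_simps1)
    have H1': "((H \<circ> real_of_ereal) \<longlongrightarrow> pi / 2) (at_left \<infinity>)"
      using H1 by (simp only: ereal_tendsto_simps1)
    have H': "(H has_real_derivative (1 - cos v) / v\<^sup>2) (at v)" if "0 < ereal v" for v
      using H that by (simp add: zero_ereal_def)
    have cont: "isCont (\<lambda>v::real. (1 - cos v) / v\<^sup>2) v" if "0 < ereal v" for v
      using that by (intro isCont_divide isCont_diff isCont_cos isCont_power) (auto simp: zero_ereal_def)
    have *: "set_integrable lborel (einterval 0 \<infinity>) (\<lambda>v::real. (1 - cos v) / v\<^sup>2)"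
        "(LBINT v=0..\<infinity>. (1 - cos v) / v\<^sup>2) = pi / 2 - 0"
      using H' cont by (intro interval_integral_FTC_nonneg[OF _ _ _ _ H0' H1']; simp)+
    \<comment> \<open>At v = 0 the integrand is 0/0 = 0, so the half-line may be closed, as the rule
      for even functions expects.\<close>
    have "(\<lambda>v. indicat_real (einterval 0 \<infinity>) v *\<^sub>R ((1 - cos v) / v\<^sup>2)) = (\<lambda>v. indicat_real {0..} v *\<^sub>R ((1 - cos v) / v\<^sup>2))"
      by (auto simp: fun_eq_iff indicator_def einterval_def zero_ereal_def)
    then have "has_bochner_integral lborel (\<lambda>v::real. indicat_real {0..} v *\<^sub>R ((1 - cos v) / v\<^sup>2)) (pi / 2)"
      using * by (simp add: has_bochner_integral_iff set_integrable_def set_lebesgue_integral_def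
         interval_lebesgue_integral_def)
    from has_bochner_integral_even_function[OF this] show ?thesis by simp
  qed
  show ?thesis
  proof (cases "a = 0")
    case False
    have *: "has_bochner_integral lborel (\<lambda>v. a\<^sup>2 * ((1 - cos (0 + a * v)) / (0 + a * v)\<^sup>2)) (a\<^sup>2 * (pi /\<^sub>R \<bar>a\<bar>))"
      by (intro has_bochner_integral_mult_right
          lborel_has_bochner_integral_real_affine_iff[THEN iffD1, OF False base])
    have "a\<^sup>2 * (pi /\<^sub>R \<bar>a\<bar>) = pi * \<bar>a\<bar>"
      using False by (simp add: field_simps power2_eq_square abs_if)
    from *[unfolded this] show ?thesis
      using False by (simp add: power_mult_distrib)
  qed (simp add: has_bochner_integral_zero)
qed

text \<open>Off 0, \<open>fejer v * cos (t * v)\<close> is the second difference of (1 - cos (a v))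
  / v^2 over a = t + 1, t, t - 1, because 2 cos (tv) cos v = cos ((t+1)v) + cos ((t-1)v). The
  integrals then combine to pi (|t+1| + |t-1| - 2|t|), which is 2 pi \<open>tri t\<close>. The sine
  part is odd and vanishes under v -> -v.\<close>

lemma has_bochner_integral_fejer_iexp:
  "has_bochner_integral lborel (\<lambda>v. fejer v *\<^sub>R iexp (t * v)) (complex_of_real (2 * pi * tri t))"
proof -
  have cos: "has_bochner_integral lborel (\<lambda>v. fejer v * cos (t * v)) (2 * pi * tri t)" for t
  proof -
    have "has_bochner_integral lborel
       (\<lambda>v. (1 - cos ((t + 1) * v)) / v\<^sup>2 + (1 - cos ((t - 1) * v)) / v\<^sup>2 - 2 * ((1 - cos (t * v)) / v\<^sup>2))
       (pi * \<bar>t + 1\<bar> + pi * \<bar>t - 1\<bar> - 2 * (pi * \<bar>t\<bar>))"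
      by (intro has_bochner_integral_add has_bochner_integral_diff has_bochner_integral_mult_right
          has_bochner_integral_one_minus_cos)
    moreover have "pi * \<bar>t + 1\<bar> + pi * \<bar>t - 1\<bar> - 2 * (pi * \<bar>t\<bar>) = 2 * pi * tri t"
      by (auto simp: tri_def abs_if max_def algebra_simps)
    moreover have "AE v in lborel. (1 - cos ((t + 1) * v)) / v\<^sup>2 + (1 - cos ((t - 1) * v)) / v\<^sup>2
        - 2 * ((1 - cos (t * v)) / v\<^sup>2) = fejer v * cos (t * v)"
      using AE_lborel_singleton[of 0]
    proof eventually_elim
      case (elim v)
      then show ?case
        by (simp add: fejer_eq field_simps cos_add cos_diff)
    qed
    ultimately show ?thesis
      by (subst has_bochner_integral_cong_AE[symmetric]) auto
  qed
  from cos[of 0] have "integrable lborel fejer"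
    by (simp add: has_bochner_integral_iff)
  then have "integrable lborel (\<lambda>v. fejer v * sin (t * v))"
    by (rule Bochner_Integration.integrable_bound) (auto simp: abs_mult mult_left_le)
  moreover have "(LINT v|lborel. fejer v * sin (t * v)) = 0"
    using lborel_integral_real_affine[of "-1" "\<lambda>v. fejer v * sin (t * v)" 0] by simp
  ultimately have sin: "has_bochner_integral lborel (\<lambda>v. fejer v * sin (t * v)) 0"
    by (simp add: has_bochner_integral_iff)
  have "has_bochner_integral lborel (\<lambda>v. of_real (fejer v * cos (t * v)) + \<i> * of_real (fejer v * sin (t * v)))
     (of_real (2 * pi * tri t) + \<i> * of_real 0)"
    by (intro has_bochner_integral_add has_bochner_integral_mult_right has_bochner_integral_of_real cos sin)
  then show ?thesis
    by (simp add: scaleR_conv_of_real cis_conv_exp[symmetric] cis.code complex_eq_iff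
       Complex_eq algebra_simps flip: of_real_mult)
qed

lemma fejer_le_1: "fejer v \<le> 1"
proof -
  have "\<bar>sinc (v / 2)\<bar> \<le> 1"
    using abs_sin_x_le_abs_x[of "v / 2"] by (auto simp: divide_le_eq)
  then show ?thesis
    unfolding fejer_def by (simp add: abs_square_le_1)
qed

lemma integrable_tri: "integrable lborel tri"
  using has_bochner_integral_Re[OF has_bochner_integral_tri_iexp[of 0]] by (simp add: has_bochner_integral_iff)

lemma has_bochner_integral_tri_shift_iexp:
  "has_bochner_integral lborel (\<lambda>s. tri (s - t) *\<^sub>R iexp (s * v)) (iexp (t * v) * fejer v)"
proof -
  have "has_bochner_integral lborel (\<lambda>s. iexp (t * v) * (tri (- t + 1 * s) *\<^sub>R iexp ((- t + 1 * s) * v)))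
     (iexp (t * v) * (of_real (fejer v) /\<^sub>R \<bar>1\<bar>))"
    by (intro has_bochner_integral_mult_right
        lborel_has_bochner_integral_real_affine_iff[THEN iffD1, OF _ has_bochner_integral_tri_iexp]) simp
  moreover have "(\<lambda>s. iexp (t * v) * (tri (- t + 1 * s) *\<^sub>R iexp ((- t + 1 * s) * v))) = (\<lambda>s. tri (s - t) *\<^sub>R iexp (s * v))"
    by (auto simp: fun_eq_iff algebra_simps simp flip: exp_add)
  ultimately show ?thesis by simp
qed

section \<open>Weak convergence of Fejer-weighted masses\<close>

text \<open>The Fejer-de la Vallee Poussin law, whose characteristic function is the compactly
  supported \<open>tri\<close>.\<close>

definition fejer_distr :: "real measure" where
  "fejer_distr = density lborel (\<lambda>v. ennreal (fejer v / (2 * pi)))"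

lemma integrable_fejer: "integrable lborel fejer"
  using has_bochner_integral_fejer_iexp[of 0, THEN has_bochner_integral_Re]
  by (simp add: has_bochner_integral_iff)

lemma integral_fejer_distr:
  fixes g :: "real \<Rightarrow> 'a :: {banach, second_countable_topology}"
  assumes [measurable]: "g \<in> borel_measurable borel"
  shows "integral\<^sup>L fejer_distr g = (LINT v|lborel. (fejer v / (2 * pi)) *\<^sub>R g v)"
  unfolding fejer_distr_def by (subst integral_density) auto

lemma real_distribution_fejer: "real_distribution fejer_distr"
proof -
  have "(LINT v|lborel. fejer v) = 2 * pi"
    using has_bochner_integral_fejer_iexp[of 0, THEN has_bochner_integral_Re]
    by (simp add: has_bochner_integral_iff)
  then have "(\<integral>\<^sup>+v. ennreal (fejer v / (2 * pi)) \<partial>lborel) = 1"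
    using integrable_fejer by (subst nn_integral_eq_integral) auto
  then have "prob_space fejer_distr"
    by (intro prob_spaceI) (simp add: fejer_distr_def emeasure_density)
  then show ?thesis
    by (intro real_distribution.intro real_distribution_axioms.intro) (simp_all add: fejer_distr_def)
qed

lemma char_fejer_distr: "char fejer_distr t = of_real (tri t)"
proof -
  have "(LINT v|lborel. (1 / (2 * pi)) *\<^sub>R (fejer v *\<^sub>R iexp (t * v))) = (1 / (2 * pi)) *\<^sub>R of_real (2 * pi * tri t)"
    using has_bochner_integral_fejer_iexp[of t] by (simp only: has_bochner_integral_iff integral_scaleR_right)
  then show ?thesis
    unfolding char_def by (subst integral_fejer_distr) (auto simp: scaleR_conv_of_real)
qed

definition discrete_distr :: "(nat \<Rightarrow> real) \<Rightarrow> (nat \<Rightarrow> real) \<Rightarrow> real measure" where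
  "discrete_distr w v = distr (density (count_space UNIV) (\<lambda>n. ennreal (w n))) borel v"

lemma real_distribution_discrete:
  assumes "\<And>n. w n \<ge> 0" "w sums 1"
  shows "real_distribution (discrete_distr w v)"
proof -
  have "(\<integral>\<^sup>+n. ennreal (w n) \<partial>count_space UNIV) = 1"
    using assms by (simp add: nn_integral_count_space_nat suminf_ennreal_eq sums_unique[symmetric])
  then have "prob_space (density (count_space UNIV) (\<lambda>n. ennreal (w n)))"
    by (intro prob_spaceI) (simp add: emeasure_density)
  then have "prob_space (discrete_distr w v)"
    unfolding discrete_distr_def by (rule prob_space.prob_space_distr) auto
  then show ?thesis
    by (intro real_distribution.intro real_distribution_axioms.intro) (simp_all add: discrete_distr_def)
qed

lemma integral_discrete_distr:
  fixes g :: "real \<Rightarrow> 'a :: {banach, second_countable_topology}"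
  assumes "\<And>n. w n \<ge> 0" "summable w" "g \<in> borel_measurable borel" "\<And>y. norm (g y) \<le> B"
  shows "integral\<^sup>L (discrete_distr w v) g = (\<Sum>n. w n *\<^sub>R g (v n))"
proof -
  have "summable (\<lambda>n. norm (w n *\<^sub>R g (v n)))"
  proof (rule summable_comparison_test_ev)
    show "summable (\<lambda>n. w n * B)"
      using assms by (intro summable_mult2)
    show "eventually (\<lambda>n. norm (norm (w n *\<^sub>R g (v n))) \<le> w n * B) sequentially"
      using assms by (intro always_eventually allI) (auto intro!: mult_left_mono)
  qed
  then show ?thesis
    unfolding discrete_distr_def using assms
    by (subst integral_distr, simp, simp, subst integral_density)
      (auto simp: integral_count_space_nat integrable_count_space_nat_iff)
qed

text \<open>The Fejer kernel weight keeps the measures finite while only Fourier transforms of compact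
  support are needed.  It is positive on [-1, 1], so it can be divided out in the limit.\<close>

lemma tendsto_window_sum:
  fixes b v :: "nat \<Rightarrow> nat \<Rightarrow> real" and L p q :: real
  assumes nonneg: "\<And>N n. b N n \<ge> 0"
    and summable: "eventually (\<lambda>N. summable (\<lambda>n. b N n * fejer (v N n))) sequentially"
    and lim: "\<And>t. (\<lambda>N. \<Sum>n. of_real (b N n * fejer (v N n)) * iexp (t * v N n)) \<longlonglongrightarrow> of_real (L * tri t)"
    and "L > 0" "-1 \<le> p" "p \<le> q" "q \<le> 1"
  shows "(\<lambda>N. \<Sum>n. if v N n \<in> {p..q} then b N n * exp (v N n) else 0) \<longlonglongrightarrow> L / (2 * pi) * (exp q - exp p)"
proof -
  define W where "W N n = b N n * fejer (v N n)" for N n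
  define T where "T N = (\<Sum>n. W N n)" for N
  define good where "good N \<longleftrightarrow> T N > 0 \<and> summable (W N)" for N
  \<comment> \<open>Levy's theorem wants a probability law for every N. For the finitely many N
    where the weights cannot be normalised, the limit law is a harmless default.\<close>
  define M where "M N = (if good N then discrete_distr (\<lambda>n. W N n / T N) (v N) else fejer_distr)" for N
  have W: "W N n \<ge> 0" for N n
    using nonneg by (simp add: W_def)
  have ev_summable: "eventually (\<lambda>N. summable (W N)) sequentially"
    using summable unfolding W_def .
  \<comment> \<open>The hypothesis at t = 0 is the convergence of the total masses, since
    \<open>tri 0 = 1\<close>.\<close>
  have "(\<lambda>N. Re (\<Sum>n. of_real (b N n * fejer (v N n)) * iexp (0 * v N n))) \<longlonglongrightarrow> Re (of_real (L * tri 0))"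
    by (intro tendsto_Re lim)
  moreover have "eventually (\<lambda>N. Re (\<Sum>n. of_real (b N n * fejer (v N n)) * iexp (0 * v N n)) = T N) sequentially"
    using ev_summable
  proof eventually_elim
    case (elim N)
    from suminf_of_real[OF this, where ?'a = complex, symmetric] show ?case
      by (simp add: T_def W_def)
  qed
  ultimately have T: "T \<longlonglongrightarrow> L"
    by (auto elim!: Lim_transform_eventually)
  have good: "eventually good sequentially"
    using ev_summable order_tendstoD(1)[OF T \<open>L > 0\<close>] by eventually_elim (simp add: good_def)
  have sums1: "(\<lambda>n. W N n / T N) sums 1" if "good N" for N
    using that sums_divide[OF summable_sums, of "W N" "T N"] by (simp add: good_def T_def)
  have int_M: "integral\<^sup>L (M N) g = (\<Sum>n. (W N n / T N) *\<^sub>R g (v N n))"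
    if "good N" "g \<in> borel_measurable borel" "\<And>y. norm (g y) \<le> B"
    for N B and g :: "real \<Rightarrow> 'b :: {banach, second_countable_topology}"
    using that W sums1[of N] unfolding M_def
    by (simp, intro integral_discrete_distr) (auto simp: good_def sums_iff)
  have "weak_conv_m M fejer_distr"
  proof (rule levy_continuity)
    show "real_distribution (M N)" for N
      using W sums1[of N] by (auto simp: M_def good_def real_distribution_fejer intro!: real_distribution_discrete)
    show "real_distribution fejer_distr"
      by (rule real_distribution_fejer)
    fix t
    have "(\<lambda>N. (\<Sum>n. of_real (b N n * fejer (v N n)) * iexp (t * v N n)) / T N) \<longlonglongrightarrow> of_real (L * tri t) / of_real L"
      using \<open>L > 0\<close> by (intro tendsto_intros lim T) auto
    moreover have "eventually (\<lambda>N. (\<Sum>n. of_real (b N n * fejer (v N n)) * iexp (t * v N n)) / T N = char (M N) t) sequentially"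
      using good
    proof eventually_elim
      case (elim N)
      have "summable (\<lambda>n. norm (of_real (W N n) * iexp (t * v N n)))"
        using elim W by (simp add: norm_mult good_def)
      then have "summable (\<lambda>n. of_real (W N n) * iexp (t * v N n))"
        by (rule summable_norm_cancel)
      from suminf_divide[OF this, of "of_real (T N)"] show ?case
        unfolding char_def by (subst int_M[OF elim, of _ 1]) (auto simp: W_def scaleR_conv_of_real)
    qed
    ultimately show "(\<lambda>N. char (M N) t) \<longlonglongrightarrow> char fejer_distr t"
      using \<open>L > 0\<close> by (auto elim!: Lim_transform_eventually simp: char_fejer_distr)
  qed
  \<comment> \<open>This test function removes the Fejer weight on the window and inserts the factor
    e^y. It is bounded because \<open>fejer\<close> is bounded away from 0 on the compact window,
    and it is discontinuous at most at p and q, which an absolutely continuous limit law does not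
    charge.\<close>
  define \<phi> where "\<phi> y = indicat_real {p..q} y * (exp y / fejer y)" for y
  have pos: "fejer y > 0" if "y \<in> {p..q}" for y
    using that assms by (intro fejer_pos) auto
  have \<phi>_meas [measurable]: "\<phi> \<in> borel_measurable borel"
    unfolding \<phi>_def by measurable
  have "continuous_on {p..q} (\<lambda>y. exp y / fejer y)"
    using pos by (intro continuous_intros continuous_at_imp_continuous_on ballI isCont_fejer) (auto simp: less_le)
  from compact_imp_bounded[OF compact_continuous_image[OF this]] obtain B
    where "\<forall>y\<in>{p..q}. \<bar>exp y / fejer y\<bar> \<le> B"
    by (auto simp: bounded_iff simp del: abs_divide)
  then have \<phi>_bound: "norm (\<phi> y) \<le> max 0 B" for y
    by (cases "y \<in> {p..q}") (auto simp: \<phi>_def le_max_iff_disj)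
  have "isCont \<phi> y" if ne: "y \<notin> {p, q}" for y
  proof -
    consider "y < p \<or> y > q" | "y \<in> {p<..<q}" using ne by fastforce
    then show ?thesis
    proof cases
      case 1
      then have "y \<in> - {p..q}" "open (- {p..q})" by auto
      then have "eventually (\<lambda>y. y \<in> - {p..q}) (nhds y)" by (intro eventually_nhds_in_open)
      then have "eventually (\<lambda>y. \<phi> y = 0) (nhds y)"
        by eventually_elim (auto simp: \<phi>_def)
      from isCont_cong[OF this] show ?thesis by simp
    next
      case 2
      then have "eventually (\<lambda>y. y \<in> {p<..<q}) (nhds y)" by (intro eventually_nhds_in_open) auto
      then have ev: "eventually (\<lambda>y. \<phi> y = exp y / fejer y) (nhds y)"
        by eventually_elim (auto simp: \<phi>_def)
      have "isCont (\<lambda>y. exp y / fejer y) y"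
        using pos[of y] 2 by (intro continuous_intros isCont_fejer) auto
      with isCont_cong[OF ev] show ?thesis by simp
    qed
  qed
  then have disc: "{y. \<not> isCont \<phi> y} \<subseteq> {p, q}" by blast
  then have "{y. \<not> isCont \<phi> y} \<in> null_sets lborel"
    by (intro finite_imp_null_set_lborel) (auto intro: finite_subset)
  then have "{y. \<not> isCont \<phi> y} \<in> null_sets fejer_distr"
    unfolding fejer_distr_def
    by (subst null_sets_density_iff) (auto dest: AE_not_in)
  then have "emeasure fejer_distr {y. \<not> isCont \<phi> y} = 0" by auto
  moreover have "real_distribution (M N)" for N
    using W sums1[of N] by (auto simp: M_def good_def real_distribution_fejer intro!: real_distribution_discrete)
  ultimately have "(\<lambda>N. integral\<^sup>L (M N) \<phi>) \<longlonglongrightarrow> integral\<^sup>L fejer_distr \<phi>"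
    using \<open>weak_conv_m M fejer_distr\<close> \<phi>_bound
    by (intro weak_conv_imp_bdd_ae_continuous_conv) (auto intro: real_distribution_fejer)
  then have "(\<lambda>N. T N * integral\<^sup>L (M N) \<phi>) \<longlonglongrightarrow> L * integral\<^sup>L fejer_distr \<phi>"
    by (intro tendsto_mult T)
  moreover have "integral\<^sup>L fejer_distr \<phi> = (exp q - exp p) / (2 * pi)"
  proof -
    have "has_bochner_integral lborel (\<lambda>y. indicator {p..q} y *\<^sub>R exp y) (exp q - exp p)"
      using \<open>p \<le> q\<close>
      by (intro has_bochner_integral_FTC_Icc continuous_intros)
        (auto intro!: derivative_eq_intros simp flip: has_real_derivative_iff_has_vector_derivative)
    then have "has_bochner_integral lborel (\<lambda>y. indicator {p..q} y *\<^sub>R exp y / (2 * pi)) ((exp q - exp p) / (2 * pi))"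
      by (rule has_bochner_integral_divide_zero)
    also have "(\<lambda>y. indicator {p..q} y *\<^sub>R exp y / (2 * pi)) = (\<lambda>y. (fejer y / (2 * pi)) *\<^sub>R \<phi> y)"
      using pos by (auto simp: \<phi>_def fun_eq_iff indicator_def less_le)
    finally show ?thesis
      by (subst integral_fejer_distr) (auto simp: has_bochner_integral_iff)
  qed
  moreover have "eventually (\<lambda>N. T N * integral\<^sup>L (M N) \<phi> = (\<Sum>n. if v N n \<in> {p..q} then b N n * exp (v N n) else 0)) sequentially"
    using good
  proof eventually_elim
    case (elim N)
    have "summable (\<lambda>n. W N n / T N * \<phi> (v N n))"
    proof (rule summable_comparison_test')
      show "summable (\<lambda>n. W N n / T N * max 0 B)"
        using sums1[OF elim] by (intro summable_mult2) (auto simp: sums_iff)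
      show "norm (W N n / T N * \<phi> (v N n)) \<le> W N n / T N * max 0 B" for n
        using \<phi>_bound[of "v N n"] W[of N n] elim by (auto simp: abs_mult good_def intro!: mult_left_mono divide_right_mono)
    qed
    then have "T N * integral\<^sup>L (M N) \<phi> = (\<Sum>n. T N * (W N n / T N * \<phi> (v N n)))"
      using int_M[OF elim \<phi>_meas \<phi>_bound] suminf_mult[of _ "T N"] by (simp only: real_scaleR_def)
    also have "(\<lambda>n. T N * (W N n / T N * \<phi> (v N n))) = (\<lambda>n. if v N n \<in> {p..q} then b N n * exp (v N n) else 0)"
      using elim pos by (fastforce simp: fun_eq_iff W_def \<phi>_def good_def)
    finally show ?case .
  qed
  ultimately show ?thesis
    by (auto elim!: Lim_transform_eventually)
qed

section \<open>The saddle point integral\<close>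

lemma has_bochner_integral_gaussian:
  assumes "a > 0"
  shows "has_bochner_integral lborel (\<lambda>u. exp (- a * u\<^sup>2)) (sqrt (pi / a))"
proof -
  define \<sigma> where "\<sigma> = 1 / sqrt (2 * a)"
  have \<sigma>: "\<sigma> > 0" "\<sigma>\<^sup>2 = 1 / (2 * a)"
    using assms by (auto simp: \<sigma>_def power_divide)
  have "has_bochner_integral lborel (\<lambda>u. sqrt (pi / a) * normal_density 0 \<sigma> u) (sqrt (pi / a) * 1)"
    using \<sigma> by (intro has_bochner_integral_mult_right) (simp add: has_bochner_integral_iff)
  then show ?thesis
    using assms \<sigma> by (simp add: normal_density_def mult.commute)
qed

text \<open>The binomial series without its first two terms, divided by z^2, is again a power
  series; its limit at 0 is the constant coefficient, a choose 2.\<close>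

lemma powr_second_order_tendsto:
  fixes a :: complex
  shows "((\<lambda>z. ((1 + z) powr a - 1 - a * z) / z\<^sup>2) \<longlongrightarrow> a * (a - 1) / 2) (at 0)"
proof -
  have "(\<lambda>n. (a gchoose (n + 2)) * z ^ n) sums (((1 + z) powr a - 1 - a * z) / z\<^sup>2)"
    if "z \<noteq> 0" "norm z < 1" for z
  proof -
    have "(\<lambda>n. (a gchoose (n + 2)) * z ^ (n + 2) / z\<^sup>2) sums
        (((1 + z) powr a - (\<Sum>n<2. (a gchoose n) * z ^ n)) / z\<^sup>2)"
      by (intro sums_divide sums_split_initial_segment gen_binomial_complex that)
    then show ?thesis
      using that by (simp add: power_add numeral_2_eq_2 algebra_simps)
  qed
  from powser_limit_0_strong[OF zero_less_one this]
  have "((\<lambda>z. ((1 + z) powr a - 1 - a * z) / z\<^sup>2) \<longlongrightarrow> a gchoose (0 + 2)) (at 0)" .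
  then show ?thesis
    by (simp add: gbinomial_altdef_of_nat numeral_2_eq_2 prod.atLeast0_lessThan_Suc)
qed

text \<open>The choice of the saddle point shows here: with z = -iu / sqrt \<Lambda> the oscillating
  factor cancels exactly the linear term of the binomial expansion. What remains is quadratic, and
  \<Lambda> z^2 = -u^2 no longer depends on N.\<close>

lemma saddle_exponent_tendsto:
  fixes \<Lambda> :: "nat \<Rightarrow> real"
  assumes \<Lambda>: "filterlim \<Lambda> at_top sequentially" and "\<rho> > 0"
  shows "(\<lambda>N. exp (of_real (\<Lambda> N / \<rho>) * ((1 - \<i> * of_real (u / sqrt (\<Lambda> N))) powr of_real (- \<rho>) - 1))
      * iexp (- u * sqrt (\<Lambda> N))) \<longlonglongrightarrow> of_real (exp (- (1 + \<rho>) / 2 * u\<^sup>2))"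
\<comment> \<open>The second-order quotient is divided by z^2, so z must stay away from 0; for u = 0
  both sides are 1.\<close>
proof (cases "u = 0")
  case False
  define z where "z N = - \<i> * of_real (u / sqrt (\<Lambda> N))" for N
  have pos: "eventually (\<lambda>N. \<Lambda> N > 0) sequentially"
    using \<Lambda> by (simp add: filterlim_at_top_dense)
  have "(\<lambda>N. u / sqrt (\<Lambda> N)) \<longlonglongrightarrow> 0"
    by (intro tendsto_divide_0[OF tendsto_const] filterlim_at_top_imp_at_infinity
        filterlim_compose[OF sqrt_at_top \<Lambda>])
  then have "(\<lambda>N. - \<i> * of_real (u / sqrt (\<Lambda> N))) \<longlonglongrightarrow> - \<i> * of_real 0"
    by (intro tendsto_intros)
  then have "z \<longlonglongrightarrow> 0" by (simp add: z_def[abs_def])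
  moreover have "eventually (\<lambda>N. z N \<noteq> 0) sequentially"
    using pos by eventually_elim (use False in \<open>auto simp: z_def\<close>)
  ultimately have "filterlim z (at 0) sequentially"
    by (auto simp: filterlim_at)
  from filterlim_compose[OF powr_second_order_tendsto[of "of_real (- \<rho>)"] this]
  have "(\<lambda>N. of_real (- u\<^sup>2 / \<rho>) * (((1 + z N) powr of_real (- \<rho>) - 1 - of_real (- \<rho>) * z N) / (z N)\<^sup>2))
     \<longlonglongrightarrow> of_real (- u\<^sup>2 / \<rho>) * (of_real (- \<rho>) * (of_real (- \<rho>) - 1) / 2)" (is "?X \<longlonglongrightarrow> ?l")
    by (rule tendsto_mult[OF tendsto_const])
  moreover have "?l = of_real (- (1 + \<rho>) / 2 * u\<^sup>2)"
    using \<open>\<rho> > 0\<close> by (simp add: field_simps)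
  moreover have "eventually (\<lambda>N. ?X N = of_real (\<Lambda> N / \<rho>) * ((1 + z N) powr of_real (- \<rho>) - 1)
      + \<i> * of_real (- u * sqrt (\<Lambda> N))) sequentially"
    using pos
  proof eventually_elim
    case (elim N)
    define p where "p = (1 + z N) powr of_real (- \<rho>)"
    define r where "r = complex_of_real (sqrt (\<Lambda> N))"
    have r: "r\<^sup>2 = of_real (\<Lambda> N)" "r \<noteq> 0"
      using elim by (simp_all add: r_def flip: of_real_power)
    have z: "z N = - \<i> * u / r" by (simp add: z_def r_def)
    show ?case
      using \<open>\<rho> > 0\<close> False r(2) unfolding p_def[symmetric]
      by (simp add: z power_divide power_mult_distrib field_simps flip: r(1) r_def)
        (simp add: power2_eq_square)
  qed
  ultimately have "(\<lambda>N. of_real (\<Lambda> N / \<rho>) * ((1 + z N) powr of_real (- \<rho>) - 1)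
      + \<i> * of_real (- u * sqrt (\<Lambda> N))) \<longlonglongrightarrow> of_real (- (1 + \<rho>) / 2 * u\<^sup>2)"
    by (auto elim: Lim_transform_eventually)
  from tendsto_exp[OF this] show ?thesis
    by (simp only: exp_add z_def exp_of_real) simp
qed simp

section \<open>Estimates for powers of 1 - i s\<close>

lemma norm_one_minus_ii_bounds:
  "1 \<le> norm (1 - \<i> * of_real s)" "norm (1 - \<i> * of_real s) \<le> 1 + \<bar>s\<bar>"
proof -
  show "1 \<le> norm (1 - \<i> * of_real s)"
    using abs_Re_le_cmod[of "1 - \<i> * of_real s"] by simp
  show "norm (1 - \<i> * of_real s) \<le> 1 + \<bar>s\<bar>"
    using norm_triangle_ineq4[of 1 "\<i> * of_real s"] by (simp add: norm_mult)
qed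

text \<open>The base has modulus at least 1, so passing to the exponent
  \<open>\<bar>\<gamma>\<bar>\<close> handles both signs of \<gamma> at once.\<close>

lemma norm_powr_one_minus_ii_le:
  assumes "\<bar>s\<bar> \<le> K"
  shows "norm ((1 - \<i> * of_real s) powr of_real \<gamma>) \<le> (1 + K) powr \<bar>\<gamma>\<bar>"
proof -
  define r where "r = norm (1 - \<i> * of_real s)"
  have r: "1 \<le> r" "r \<le> 1 + K"
    using norm_one_minus_ii_bounds[of s] assms by (auto simp: r_def)
  have "norm ((1 - \<i> * of_real s) powr of_real \<gamma>) = r powr \<gamma>"
    by (simp add: norm_powr_real_powr' r_def)
  also have "\<dots> \<le> r powr \<bar>\<gamma>\<bar>"
    using r by (intro powr_mono) auto
  also have "\<dots> \<le> (1 + K) powr \<bar>\<gamma>\<bar>"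
    using r by (intro powr_mono2) auto
  finally show ?thesis .
qed

text \<open>The phase can be discarded: the modulus (1 + s^2)^(-\<rho>/2) alone already decays
  quadratically on a bounded interval.\<close>

lemma Re_powr_one_minus_ii_le:
  assumes "\<rho> > 0" "K \<ge> 0"
  obtains d where "d > 0"
    "\<And>s. \<bar>s\<bar> \<le> K \<Longrightarrow> Re ((1 - \<i> * of_real s) powr of_real (- \<rho>)) - 1 \<le> - d * s\<^sup>2"
proof
  define a where "a = \<rho> / 2"
  \<comment> \<open>The factor 1 + K^2 comes from ln (1 + s^2) >= s^2 / (1 + s^2), and 1 + a from
    exp (-y) <= 1 - y / (1 + y) with y <= a.\<close>
  define d where "d = a / ((1 + K\<^sup>2) * (1 + a))"
  have "a > 0" using assms by (simp add: a_def)
  then show "d > 0" by (simp add: d_def add_pos_nonneg)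
  fix s assume s: "\<bar>s\<bar> \<le> K"
  define y where "y = a * s\<^sup>2 / (1 + K\<^sup>2)"
  have s2: "s\<^sup>2 \<le> K\<^sup>2" using s power_mono[of "\<bar>s\<bar>" K 2] by simp
  then have y: "0 \<le> y" "y \<le> a"
    using \<open>a > 0\<close> by (auto simp: y_def divide_le_eq add_pos_nonneg)
  have "s\<^sup>2 / (1 + K\<^sup>2) \<le> s\<^sup>2 / (1 + s\<^sup>2)"
    using s2 by (intro divide_left_mono) (auto simp: add_pos_nonneg)
  also have "\<dots> \<le> ln (1 + s\<^sup>2)"
  proof -
    have "ln (1 / (1 + s\<^sup>2)) \<le> 1 / (1 + s\<^sup>2) - 1"
      by (intro ln_le_minus_one) (auto simp: add_pos_nonneg)
    moreover have "ln (1 / (1 + s\<^sup>2)) = - ln (1 + s\<^sup>2)"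
      by (subst ln_div) (auto simp: add_pos_nonneg)
    moreover have "1 + s\<^sup>2 \<noteq> 0" using add_pos_nonneg[of 1 "s\<^sup>2"] by simp
    ultimately show ?thesis by (simp add: field_simps)
  qed
  finally have ln: "s\<^sup>2 / (1 + K\<^sup>2) \<le> ln (1 + s\<^sup>2)" .
  have "Re ((1 - \<i> * of_real s) powr of_real (- \<rho>)) \<le> norm ((1 - \<i> * of_real s) powr of_real (- \<rho>))"
    by (rule complex_Re_le_cmod)
  also have "\<dots> = norm (1 - \<i> * of_real s) powr (- \<rho>)"
    by (subst norm_powr_real_powr') auto
  also have "norm (1 - \<i> * of_real s) = (1 + s\<^sup>2) powr (1 / 2)"
    by (simp add: cmod_def powr_half_sqrt)
  also have "\<dots> powr (- \<rho>) = exp (- (a * ln (1 + s\<^sup>2)))"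
    using add_pos_nonneg[of 1 "s\<^sup>2"] by (simp add: powr_powr powr_def a_def)
  also have "\<dots> \<le> exp (- y)"
    using mult_left_mono[OF ln, of a] \<open>a > 0\<close> by (simp add: y_def)
  also have "\<dots> \<le> 1 / (1 + y)"
    using exp_ge_add_one_self[of y] y by (simp add: exp_minus field_simps)
  also have "\<dots> = 1 - y / (1 + y)"
    using y by (simp add: field_simps)
  also have "y / (1 + y) \<ge> y / (1 + a)"
    using y by (intro divide_left_mono) auto
  then have "1 - y / (1 + y) \<le> 1 - y / (1 + a)" by simp
  also have "y / (1 + a) = d * s\<^sup>2"
    by (simp add: y_def d_def)
  finally show "Re ((1 - \<i> * of_real s) powr of_real (- \<rho>)) - 1 \<le> - d * s\<^sup>2" by simp
qed

section \<open>The main term along rays from 0\<close>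

definition growth :: "real \<Rightarrow> real \<Rightarrow> real \<Rightarrow> real \<Rightarrow> complex \<Rightarrow> complex" where
  "growth \<alpha> \<beta> \<gamma> \<rho> z = of_real \<alpha> * z powr of_real \<gamma> * exp (of_real \<beta> * z powr of_real (- \<rho>) / of_real \<rho>)"

definition rgrowth :: "real \<Rightarrow> real \<Rightarrow> real \<Rightarrow> real \<Rightarrow> real \<Rightarrow> real" where
  "rgrowth \<alpha> \<beta> \<gamma> \<rho> x = \<alpha> * x powr \<gamma> * exp (\<beta> * x powr (- \<rho>) / \<rho>)"

text \<open>A positive factor x does not move the principal branch, so the powers split. The
  \<open>- 1\<close> in the exponent normalises the second factor to 1 at z = 1, leaving
  \<open>rgrowth\<close> as the value at x itself.\<close>

lemma growth_ray:
  assumes "x > 0"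
  shows "growth \<alpha> \<beta> \<gamma> \<rho> (of_real x * z) = of_real (rgrowth \<alpha> \<beta> \<gamma> \<rho> x) *
    (z powr of_real \<gamma> * exp (of_real (\<beta> * x powr (- \<rho>) / \<rho>) * (z powr of_real (- \<rho>) - 1)))"
proof -
  have "(of_real x * z) powr of_real a = of_real (x powr a) * z powr of_real a" for a
    using assms by (subst powr_times_real_left) (auto simp: powr_of_real)
  then show ?thesis
    by (simp add: growth_def rgrowth_def exp_of_real[symmetric] exp_add[symmetric] algebra_simps diff_divide_distrib
       del: of_real_minus)
qed

lemma Arg_ray_bound:
  assumes "x > 0" "\<bar>s\<bar> \<le> K"
  shows "\<bar>Arg (of_real x * (1 - \<i> * of_real s))\<bar> \<le> arctan K"
proof -
  have "Arg (of_real x * (1 - \<i> * of_real s)) = arctan (- s)"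
    using assms by (subst arg_conv_arctan) auto
  also have "\<bar>arctan (- s)\<bar> = arctan \<bar>s\<bar>"
    by (auto simp: abs_if arctan_minus)
  finally show ?thesis using assms by (simp add: arctan_le_iff)
qed

text \<open>Substituting s = u / sqrt (\<Lambda> N), the integrand converges to a Gaussian, and the decay of
  Re ((1 - \<i> s)^(- \<rho>)) on bounded intervals provides a Gaussian majorant.  The kernel being compactly
  supported, only a fixed Stolz angle matters.\<close>

lemma saddle_point_tendsto:
  fixes S :: "nat \<Rightarrow> complex \<Rightarrow> complex" and x \<Lambda> :: "nat \<Rightarrow> real"
  assumes params: "\<alpha> > 0" "\<beta> > 0" "\<rho> > 0"
    and approx: "\<And>\<Delta> \<epsilon>. 0 < \<Delta> \<Longrightarrow> \<Delta> < pi / 2 \<Longrightarrow> \<epsilon> > 0 \<Longrightarrow>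
      eventually (\<lambda>z. \<forall>N. norm (S N z - growth \<alpha> \<beta> \<gamma> \<rho> z) \<le> \<epsilon> * norm (growth \<alpha> \<beta> \<gamma> \<rho> z))
        (at 0 within {z. \<bar>Arg z\<bar> \<le> \<Delta>})"
    and meas [measurable]: "\<And>N. (\<lambda>s. S N (of_real (x N) * (1 - \<i> * of_real s))) \<in> borel_measurable borel"
    and x: "filterlim x (at_right 0) sequentially"
    and \<Lambda>: "eventually (\<lambda>N. \<Lambda> N = \<beta> * x N powr (- \<rho>)) sequentially"
  shows "(\<lambda>N. of_real (sqrt (\<Lambda> N) / rgrowth \<alpha> \<beta> \<gamma> \<rho> (x N)) *
      (CLINT s|lborel. tri (s - t) *\<^sub>R (iexp (- s * \<Lambda> N) * S N (of_real (x N) * (1 - \<i> * of_real s)))))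
    \<longlonglongrightarrow> of_real (sqrt (2 * pi / (1 + \<rho>)) * tri t)"
proof -
  \<comment> \<open>\<open>tri (s - t)\<close> vanishes unless |s - t| < 1, hence unless |s| < K;
    for such s the point x (1 - i s) has argument at most arctan K < pi/2 in absolute value.\<close>
  define K where "K = \<bar>t\<bar> + 1"
  define \<Delta> where "\<Delta> = arctan K"
  have \<Delta>: "0 < \<Delta>" "\<Delta> < pi / 2"
    using arctan_ubound[of K] by (auto simp: \<Delta>_def K_def)
  have "K \<ge> 0" by (simp add: K_def)
  from Re_powr_one_minus_ii_le[OF \<open>\<rho> > 0\<close> this] obtain d where d: "d > 0"
    "\<And>s. \<bar>s\<bar> \<le> K \<Longrightarrow> Re ((1 - \<i> * of_real s) powr of_real (- \<rho>)) - 1 \<le> - d * s\<^sup>2"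
    by blast
  define E where "E = growth \<alpha> \<beta> \<gamma> \<rho>"
  define e where "e N = rgrowth \<alpha> \<beta> \<gamma> \<rho> (x N)" for N
  define w where "w s = 1 - \<i> * complex_of_real s" for s
  define r where "r N = sqrt (\<Lambda> N)" for N
  have x_pos: "eventually (\<lambda>N. x N > 0) sequentially"
    using x by (auto simp: filterlim_at eventually_conj_iff)
  have "filterlim (\<lambda>N. \<beta> * x N powr (- \<rho>)) at_top sequentially"
  proof (rule filterlim_compose[OF _ x])
    show "filterlim (\<lambda>x. \<beta> * x powr (- \<rho>)) at_top (at_right 0)"
      using params by real_asymp
  qed
  then have \<Lambda>_top: "filterlim \<Lambda> at_top sequentially"
    using filterlim_cong[OF refl refl \<Lambda>] by simp
  have \<Lambda>_pos: "eventually (\<lambda>N. \<Lambda> N > 0) sequentially"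
    using \<Lambda>_top by (simp add: filterlim_at_top_dense)
  have r_top: "filterlim r at_top sequentially"
    unfolding r_def by (rule filterlim_compose[OF sqrt_at_top \<Lambda>_top])
  \<comment> \<open>Uniform in s, because the modulus of x (1 - i s) lies between x and (1 + K) x:
    the whole segment shrinks to 0 together with x, without reaching it.\<close>
  have approx': "eventually (\<lambda>N. \<forall>s. \<bar>s\<bar> \<le> K \<longrightarrow>
      norm (S N (x N * w s) - E (x N * w s)) \<le> \<epsilon> * norm (E (x N * w s))) sequentially"
    if "\<epsilon> > 0" for \<epsilon>
  proof -
    from approx[OF \<Delta> that] obtain \<delta> where \<delta>: "\<delta> > 0"
      "\<And>z N. z \<noteq> 0 \<Longrightarrow> norm z < \<delta> \<Longrightarrow> \<bar>Arg z\<bar> \<le> \<Delta> \<Longrightarrow> norm (S N z - E z) \<le> \<epsilon> * norm (E z)"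
      by (auto simp: eventually_at dist_norm E_def)
    have "(x \<longlongrightarrow> 0) sequentially" using x by (simp add: filterlim_at)
    then have "eventually (\<lambda>N. x N < \<delta> / (1 + K)) sequentially"
      using \<delta>(1) \<open>K \<ge> 0\<close> by (intro order_tendstoD) auto
    with x_pos show ?thesis
    proof eventually_elim
      case (elim N)
      show ?case
      proof (intro allI impI \<delta>(2))
        fix s assume s: "\<bar>s\<bar> \<le> K"
        have w: "1 \<le> norm (w s)" "norm (w s) \<le> 1 + K"
          using norm_one_minus_ii_bounds[of s] s by (auto simp: w_def)
        then show "of_real (x N) * w s \<noteq> 0"
          using elim by auto
        have "norm (of_real (x N) * w s) \<le> x N * (1 + K)"
          using w elim by (simp add: norm_mult)
        also have "\<dots> < \<delta>"
          using elim \<open>K \<ge> 0\<close> by (simp add: field_simps)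
        finally show "norm (of_real (x N) * w s) < \<delta>" .
        show "\<bar>Arg (of_real (x N) * w s)\<bar> \<le> \<Delta>"
          using Arg_ray_bound[of "x N" s K] s elim by (simp add: w_def \<Delta>_def)
      qed
    qed
  qed
  define D where "D s N = w s powr of_real \<gamma> * exp (of_real (\<Lambda> N / \<rho>) * (w s powr of_real (- \<rho>) - 1))" for s N
  have E_ray: "eventually (\<lambda>N. \<forall>s. E (x N * w s) = of_real (e N) * D s N) sequentially"
    using x_pos \<Lambda> by eventually_elim (auto simp: E_def e_def D_def growth_ray)
  have e_pos: "eventually (\<lambda>N. e N > 0) sequentially"
    using x_pos by eventually_elim (auto simp: e_def rgrowth_def params)
  \<comment> \<open>The integrand after s = u / r and division by the size \<open>e N\<close> of the
    main term. The Jacobian 1 / r is what the normalising factor sqrt \<Lambda> cancels.\<close>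
  define Q where "Q N u = tri (u / r N - t) *\<^sub>R (iexp (- u * r N) * (S N (x N * w (u / r N)) / e N))" for N u
  define c where "c = d / \<rho>"
  have "c > 0" using d params by (simp add: c_def)
  \<comment> \<open>The 2 comes from using the approximation with \<epsilon> = 1, which gives |S| <=
    2 |E|.\<close>
  define B where "B = 2 * (1 + K) powr \<bar>\<gamma>\<bar>"
  have D_bound: "eventually (\<lambda>N. \<forall>u. \<bar>u / r N\<bar> \<le> K \<longrightarrow> norm (D (u / r N) N) \<le> (1 + K) powr \<bar>\<gamma>\<bar> * exp (- c * u\<^sup>2)) sequentially"
    using \<Lambda>_pos
  proof eventually_elim
    case (elim N)
    show ?case
    proof (intro allI impI)
      fix u assume u: "\<bar>u / r N\<bar> \<le> K"
      have "\<Lambda> N / \<rho> * (Re (w (u / r N) powr of_real (- \<rho>)) - 1) \<le> \<Lambda> N / \<rho> * (- d * (u / r N)\<^sup>2)"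
        using d(2)[OF u] elim params unfolding w_def by (intro mult_left_mono) auto
      also have "\<dots> = - c * u\<^sup>2"
        using elim by (simp add: c_def r_def power_divide)
      finally have "exp (\<Lambda> N / \<rho> * (Re (w (u / r N) powr of_real (- \<rho>)) - 1)) \<le> exp (- c * u\<^sup>2)"
        by simp
      then show "norm (D (u / r N) N) \<le> (1 + K) powr \<bar>\<gamma>\<bar> * exp (- c * u\<^sup>2)"
        using norm_powr_one_minus_ii_le[OF u, of \<gamma>]
        by (auto simp: D_def norm_mult norm_exp_eq_Re w_def intro!: mult_mono simp del: of_real_divide of_real_minus)
    qed
  qed
  have Q_bound: "eventually (\<lambda>N. \<forall>u. norm (Q N u) \<le> B * exp (- c * u\<^sup>2)) sequentially"
    using approx'[OF zero_less_one] E_ray e_pos D_bound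
  proof eventually_elim
    case (elim N)
    show ?case
    proof
      fix u
      show "norm (Q N u) \<le> B * exp (- c * u\<^sup>2)"
      proof (cases "\<bar>u / r N\<bar> \<le> K")
        case False
        then have "tri (u / r N - t) = 0" by (auto simp: tri_def K_def)
        then show ?thesis by (simp add: Q_def B_def)
      next
        case True
        have "norm (S N (x N * w (u / r N))) \<le> 2 * norm (E (x N * w (u / r N)))"
          using elim(1)[rule_format, OF True] norm_triangle_ineq2[of "S N (x N * w (u / r N))" "E (x N * w (u / r N))"]
          by simp
        also have "\<dots> = e N * (2 * norm (D (u / r N) N))"
          using elim(2,3) by (simp add: norm_mult)
        also have "\<dots> \<le> e N * (2 * ((1 + K) powr \<bar>\<gamma>\<bar> * exp (- c * u\<^sup>2)))"
          using elim(3,4) True by (intro mult_left_mono) auto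
        finally have "norm (S N (x N * w (u / r N)) / e N) \<le> B * exp (- c * u\<^sup>2)"
          using elim(3) by (simp add: norm_divide B_def field_simps)
        moreover have "norm (Q N u) \<le> norm (S N (x N * w (u / r N)) / e N)"
          unfolding Q_def norm_scaleR norm_mult norm_exp_i_times by (simp add: mult_left_le_one_le)
        ultimately show ?thesis by linarith
      qed
    qed
  qed
  \<comment> \<open>For fixed u the point s = u / r tends to 0. So S / E and (1 - i s)^\<gamma> tend
    to 1, the triangle tends to \<open>tri (- t)\<close>, which is \<open>tri t\<close>, and only
    the exponential contributes a nontrivial limit.\<close>
  have Q_lim: "(\<lambda>N. Q N u) \<longlonglongrightarrow> tri t *\<^sub>R of_real (exp (- (1 + \<rho>) / 2 * u\<^sup>2))" for u
  proof -
    have "(\<lambda>N. u / r N) \<longlonglongrightarrow> 0"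
      by (intro tendsto_divide_0[OF tendsto_const] filterlim_at_top_imp_at_infinity r_top)
    note lim0 = this
    have "isCont (\<lambda>s. w s powr of_real \<gamma>) 0"
      unfolding w_def by (intro continuous_intros) auto
    from isCont_tendsto_compose[OF this lim0]
    have lim1: "(\<lambda>N. w (u / r N) powr of_real \<gamma>) \<longlonglongrightarrow> 1"
      by (simp add: w_def)
    have "K > 0" by (simp add: K_def)
    then have ev_K: "eventually (\<lambda>N. \<bar>u / r N\<bar> < K) sequentially"
      using tendsto_rabs[OF lim0] by (intro order_tendstoD) auto
    have E_nz: "eventually (\<lambda>N. E (x N * w (u / r N)) \<noteq> 0) sequentially"
      using E_ray e_pos
    proof eventually_elim
      case (elim N)
      have "w (u / r N) \<noteq> 0" using norm_one_minus_ii_bounds(1)[of "u / r N"] unfolding w_def by fastforce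
      with elim show ?case by (auto simp: D_def)
    qed
    have ratio: "(\<lambda>N. S N (x N * w (u / r N)) / E (x N * w (u / r N))) \<longlonglongrightarrow> 1"
    proof (rule tendstoI, unfold dist_norm)
      fix \<epsilon> :: real assume "\<epsilon> > 0"
      then have "\<epsilon> / 2 > 0" by simp
      from approx'[OF this] ev_K E_nz
      show "eventually (\<lambda>N. norm (S N (x N * w (u / r N)) / E (x N * w (u / r N)) - 1) < \<epsilon>) sequentially"
      proof eventually_elim
        case (elim N)
        define a where "a = S N (x N * w (u / r N))"
        define b where "b = E (x N * w (u / r N))"
        have "norm (a - b) \<le> \<epsilon> / 2 * norm b" "b \<noteq> 0"
          using elim by (auto simp: a_def b_def)
        moreover have "a / b - 1 = (a - b) / b" using \<open>b \<noteq> 0\<close> by (simp add: field_simps)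
        moreover have "\<epsilon> / 2 * norm b < \<epsilon> * norm b" using \<open>\<epsilon> > 0\<close> \<open>b \<noteq> 0\<close> by simp
        ultimately show ?case
          unfolding a_def[symmetric] b_def[symmetric] by (simp add: norm_divide divide_less_eq)
      qed
    qed
    have lim2: "(\<lambda>N. tri (u / r N - t)) \<longlonglongrightarrow> tri (0 - t)"
      by (intro isCont_tendsto_compose[OF isCont_tri] tendsto_intros lim0)
    have "(\<lambda>N. tri (u / r N - t) *\<^sub>R ((S N (x N * w (u / r N)) / E (x N * w (u / r N))) * (w (u / r N) powr of_real \<gamma> *
        (exp (of_real (\<Lambda> N / \<rho>) * (w (u / r N) powr of_real (- \<rho>) - 1)) * iexp (- u * r N)))))
        \<longlonglongrightarrow> tri (0 - t) *\<^sub>R (1 * (1 * of_real (exp (- (1 + \<rho>) / 2 * u\<^sup>2))))"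
      using saddle_exponent_tendsto[OF \<Lambda>_top \<open>\<rho> > 0\<close>, of u] unfolding w_def[symmetric] r_def[symmetric]
      by (intro tendsto_scaleR tendsto_mult lim1 lim2 ratio)
    moreover have "eventually (\<lambda>N. tri (u / r N - t) *\<^sub>R ((S N (x N * w (u / r N)) / E (x N * w (u / r N))) * (w (u / r N) powr of_real \<gamma> *
        (exp (of_real (\<Lambda> N / \<rho>) * (w (u / r N) powr of_real (- \<rho>) - 1)) * iexp (- u * r N)))) = Q N u) sequentially"
      using E_ray e_pos E_nz
    proof eventually_elim
      case (elim N)
      then have "D (u / r N) N \<noteq> 0" by auto
      with elim have SD: "(S N (x N * w (u / r N)) / E (x N * w (u / r N))) * D (u / r N) N = S N (x N * w (u / r N)) / e N"
        using elim(1,2) by simp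
      show ?case
        unfolding Q_def SD[symmetric] D_def by (simp only: mult_ac)
    qed
    moreover have "tri (0 - t) = tri t" by (simp add: tri_def)
    ultimately show ?thesis
      by (auto elim: Lim_transform_eventually)
  qed
  have gauss: "integrable lborel (\<lambda>u. B * exp (- c * u\<^sup>2))"
    using has_bochner_integral_gaussian[OF \<open>c > 0\<close>] by (simp add: has_bochner_integral_iff)
  \<comment> \<open>The majorant is valid only from some index on, so dominated convergence is
    applied to the shifted sequence.\<close>
  from Q_bound obtain N0 where N0: "\<And>N u. N \<ge> N0 \<Longrightarrow> norm (Q N u) \<le> B * exp (- c * u\<^sup>2)"
    by (auto simp: eventually_sequentially)
  have Q_meas [measurable]: "Q N \<in> borel_measurable borel" for N
    unfolding Q_def[abs_def] using measurable_compose[OF _ meas[of N], of "\<lambda>u. u / r N" borel]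
    unfolding w_def[symmetric] by measurable
  have "(\<lambda>N. integral\<^sup>L lborel (Q (N + N0))) \<longlonglongrightarrow> (CLINT u|lborel. tri t *\<^sub>R of_real (exp (- (1 + \<rho>) / 2 * u\<^sup>2)))"
  proof (rule integral_dominated_convergence[OF _ _ gauss])
    show "AE u in lborel. (\<lambda>N. Q (N + N0) u) \<longlonglongrightarrow> tri t *\<^sub>R of_real (exp (- (1 + \<rho>) / 2 * u\<^sup>2))"
      by (intro AE_I2 LIMSEQ_ignore_initial_segment Q_lim)
    show "AE u in lborel. norm (Q (N + N0) u) \<le> B * exp (- c * u\<^sup>2)" for N
      by (intro AE_I2 N0) simp
  qed simp_all
  then have int_lim: "(\<lambda>N. integral\<^sup>L lborel (Q N)) \<longlonglongrightarrow> (CLINT u|lborel. tri t *\<^sub>R of_real (exp (- (1 + \<rho>) / 2 * u\<^sup>2)))"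
    by (rule LIMSEQ_offset)
  have "has_bochner_integral lborel (\<lambda>u. tri t *\<^sub>R complex_of_real (exp (- ((1 + \<rho>) / 2) * u\<^sup>2))) (tri t *\<^sub>R of_real (sqrt (pi / ((1 + \<rho>) / 2))))"
    using params by (intro has_bochner_integral_scaleR_right has_bochner_integral_of_real has_bochner_integral_gaussian) auto
  then have val: "(CLINT u|lborel. tri t *\<^sub>R complex_of_real (exp (- (1 + \<rho>) / 2 * u\<^sup>2))) = of_real (sqrt (2 * pi / (1 + \<rho>)) * tri t)"
    unfolding minus_divide_left[symmetric]
    by (simp add: has_bochner_integral_iff scaleR_conv_of_real mult_ac)
  have "eventually (\<lambda>N. integral\<^sup>L lborel (Q N) = of_real (sqrt (\<Lambda> N) / rgrowth \<alpha> \<beta> \<gamma> \<rho> (x N)) *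
      (CLINT s|lborel. tri (s - t) *\<^sub>R (iexp (- s * \<Lambda> N) * S N (of_real (x N) * (1 - \<i> * of_real s))))) sequentially"
    using \<Lambda>_pos e_pos
  proof eventually_elim
    case (elim N)
    have r: "r N > 0" "r N * r N = \<Lambda> N" using elim by (auto simp: r_def)
    have "(CLINT s|lborel. tri (s - t) *\<^sub>R (iexp (- s * \<Lambda> N) * S N (of_real (x N) * (1 - \<i> * of_real s)))) =
      (1 / r N) *\<^sub>R (CLINT u|lborel. tri (u / r N - t) *\<^sub>R (iexp (- (u / r N) * \<Lambda> N) * S N (of_real (x N) * (1 - \<i> * of_real (u / r N)))))"
      by (subst lborel_integral_real_affine[where c = "1 / r N" and t = 0]) (use r in auto)
    also have "(\<lambda>u. tri (u / r N - t) *\<^sub>R (iexp (- (u / r N) * \<Lambda> N) * S N (of_real (x N) * (1 - \<i> * of_real (u / r N)))))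
      = (\<lambda>u. of_real (e N) * Q N u)"
    proof
      fix u
      have "- (u / r N) * \<Lambda> N = - u * r N"
        using r by (simp flip: r(2))
      then show "tri (u / r N - t) *\<^sub>R (iexp (- (u / r N) * \<Lambda> N) * S N (of_real (x N) * (1 - \<i> * of_real (u / r N))))
          = of_real (e N) * Q N u"
        using elim(2) by (simp only: Q_def w_def) (simp add: scaleR_conv_of_real)
    qed
    also have "of_real (sqrt (\<Lambda> N) / rgrowth \<alpha> \<beta> \<gamma> \<rho> (x N)) * ((1 / r N) *\<^sub>R (CLINT u|lborel. of_real (e N) * Q N u)) = integral\<^sup>L lborel (Q N)"
      using r elim(2) unfolding e_def[symmetric] r_def[symmetric] by (simp add: scaleR_conv_of_real)
    finally show ?case by (rule sym)
  qed
  then show ?thesis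
    using int_lim unfolding val by (rule Lim_transform_eventually[rotated])
qed

section \<open>Residue classes\<close>

text \<open>The weight m replaces the averaging factor 1/m of the root of unity filter: every class
  then has the same main term as the full series.\<close>

definition residue_series :: "(nat \<Rightarrow> real) \<Rightarrow> nat \<Rightarrow> nat \<Rightarrow> complex \<Rightarrow> complex" where
  "residue_series c m N z = (\<Sum>n. of_real (if n mod m = N mod m then real m * c n else 0) * exp (- of_nat n * z))"

text \<open>The h-th summand is the h-th power of a single m-th root of unity, which is 1 exactly
  when m divides n - N; otherwise the geometric sum vanishes.\<close>

lemma root_of_unity_filter:
  fixes m n N :: nat
  assumes "m > 0"
  shows "(\<Sum>h<m. cis (- 2 * pi * h * N / m) * exp (2 * complex_of_real pi * \<i> * of_nat h / of_nat m) ^ n) =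
    (if n mod m = N mod m then of_nat m else 0)"
proof -
  define \<zeta> where "\<zeta> = cis (2 * pi * ((real n - real N) / m))"
  have "cis (- 2 * pi * h * N / m) * exp (2 * complex_of_real pi * \<i> * of_nat h / of_nat m) ^ n = \<zeta> ^ h" for h
  proof -
    have "exp (2 * complex_of_real pi * \<i> * of_nat h / of_nat m) = cis (2 * pi * h / m)"
      by (simp add: cis_conv_exp mult_ac)
    then show ?thesis
      by (simp add: \<zeta>_def Complex.DeMoivre cis_mult diff_divide_distrib algebra_simps)
  qed
  then have sum: "(\<Sum>h<m. cis (- 2 * pi * h * N / m) * exp (2 * complex_of_real pi * \<i> * of_nat h / of_nat m) ^ n) = (\<Sum>h<m. \<zeta> ^ h)"
    by simp
  have \<zeta>m: "\<zeta> ^ m = 1"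
  proof -
    have "\<zeta> ^ m = cis (2 * pi * of_int (int n - int N))"
      using assms by (simp add: \<zeta>_def Complex.DeMoivre)
    also have "\<dots> = 1" by (rule cis_multiple_2pi) auto
    finally show ?thesis .
  qed
  have "\<zeta> = 1 \<longleftrightarrow> n mod m = N mod m"
  proof -
    have "\<zeta> = 1 \<longleftrightarrow> (\<exists>k::int. (real n - real N) / m = of_int k)"
    proof -
      have "\<zeta> = 1 \<longleftrightarrow> (\<exists>k::int. 2 * pi * ((real n - real N) / m) = of_int (2 * k) * pi)"
        unfolding \<zeta>_def cis_conv_exp by (simp add: exp_eq_1 del: of_int_mult)
      also have "\<dots> \<longleftrightarrow> (\<exists>k::int. (real n - real N) / m = of_int k)"
        by (intro ex_cong1) (simp add: mult_ac del: times_divide_eq_right)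
      finally show ?thesis .
    qed
    also have "\<dots> \<longleftrightarrow> (\<exists>k::int. int n - int N = int m * k)"
    proof (intro ex_cong1)
      fix k :: int
      have "(real n - real N) / m = of_int k \<longleftrightarrow> real_of_int (int n - int N) = real_of_int (int m * k)"
        using assms by (simp add: field_simps)
      then show "(real n - real N) / m = of_int k \<longleftrightarrow> int n - int N = int m * k"
        by (simp only: of_int_eq_iff)
    qed
    also have "\<dots> \<longleftrightarrow> int m dvd int n - int N" by (auto simp: dvd_def)
    also have "\<dots> \<longleftrightarrow> int n mod int m = int N mod int m" by (rule mod_eq_dvd_iff[symmetric])
    also have "\<dots> \<longleftrightarrow> n mod m = N mod m" by (simp flip: of_nat_mod)
    finally show ?thesis .
  qed
  then show ?thesis
    using \<zeta>m sum by (auto simp: geometric_sum)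
qed

context
  fixes c :: "nat \<Rightarrow> real" and f :: "complex \<Rightarrow> complex" and m :: nat
  assumes power_series: "\<And>q. norm q < 1 \<Longrightarrow> (\<lambda>n. complex_of_real (c n) * q ^ n) sums f q"
    and m_pos: "m > 0"
begin

lemma residue_series_eq:
  assumes "Re z > 0"
  shows "residue_series c m N z = (\<Sum>h<m. cis (- 2 * pi * h * N / m) *
    f (exp (- z) * exp (2 * complex_of_real pi * \<i> * of_nat h / of_nat m)))"
proof -
  define \<omega> where "\<omega> h = exp (2 * complex_of_real pi * \<i> * of_nat h / of_nat m)" for h
  have "norm (\<omega> h) = 1" for h
    by (simp add: \<omega>_def norm_exp_eq_Re)
  then have "norm (exp (- z) * \<omega> h) < 1" for h
    using assms by (simp add: norm_mult norm_exp_eq_Re)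
  then have "(\<lambda>n. \<Sum>h<m. cis (- 2 * pi * h * N / m) * (of_real (c n) * (exp (- z) * \<omega> h) ^ n)) sums
      (\<Sum>h<m. cis (- 2 * pi * h * N / m) * f (exp (- z) * \<omega> h))"
    by (intro sums_sum sums_mult power_series)
  moreover have "(\<Sum>h<m. cis (- 2 * pi * h * N / m) * (of_real (c n) * (exp (- z) * \<omega> h) ^ n)) =
    of_real (if n mod m = N mod m then real m * c n else 0) * exp (- of_nat n * z)" for n
  proof -
    have "(\<Sum>h<m. cis (- 2 * pi * h * N / m) * (of_real (c n) * (exp (- z) * \<omega> h) ^ n)) =
      of_real (c n) * exp (- z) ^ n * (\<Sum>h<m. cis (- 2 * pi * h * N / m) * \<omega> h ^ n)"
      unfolding sum_distrib_left by (intro sum.cong) (auto simp: power_mult_distrib)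
    also have "exp (- z) ^ n = exp (- of_nat n * z)"
      by (simp flip: exp_of_nat_mult)
    finally show ?thesis
      unfolding \<omega>_def root_of_unity_filter[OF m_pos] by simp
  qed
  ultimately show ?thesis
    unfolding residue_series_def \<omega>_def[symmetric] by (simp add: sums_iff)
qed

text \<open>In the filtered sum h = 0 is f(e^(-z)) itself and the other terms are negligible against
  it. N enters only through coefficients of modulus 1, which gives the uniformity in N needed later,
  where N and z vary together.\<close>

lemma residue_series_approx:
  fixes E :: "complex \<Rightarrow> complex"
  assumes \<Delta>: "0 < \<Delta>" "\<Delta> < pi / 2" and "\<epsilon> > 0"
    and major: "(\<lambda>z. f (exp (- z))) \<sim>[at 0 within {z. \<bar>Arg z\<bar> \<le> \<Delta>}] E"
    and minor: "\<And>h. 1 \<le> h \<Longrightarrow> h < m \<Longrightarrow>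
      (\<lambda>z. f (exp (- z) * exp (2 * complex_of_real pi * \<i> * of_nat h / of_nat m)))
        \<in> o[at 0 within {z. \<bar>Arg z\<bar> \<le> \<Delta>}](\<lambda>z. f (exp (- z)))"
  shows "eventually (\<lambda>z. \<forall>N. norm (residue_series c m N z - E z) \<le> \<epsilon> * norm (E z))
    (at 0 within {z. \<bar>Arg z\<bar> \<le> \<Delta>})"
proof -
  define G where "G h z = f (exp (- z) * exp (2 * complex_of_real pi * \<i> * of_nat h / of_nat m))" for h z
  \<comment> \<open>One share for the error of the main term and one for each of the m - 1 other
    terms.\<close>
  define \<epsilon>' where "\<epsilon>' = \<epsilon> / m"
  have \<epsilon>': "\<epsilon>' > 0" "real m * \<epsilon>' = \<epsilon>" using \<open>\<epsilon> > 0\<close> m_pos by (auto simp: \<epsilon>'_def)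
  have "(\<lambda>z. G 0 z - E z) \<in> o[at 0 within {z. \<bar>Arg z\<bar> \<le> \<Delta>}](E)"
    using asymp_equiv_imp_diff_smallo[OF major] by (simp add: G_def)
  from landau_o.smallD[OF this \<epsilon>'(1)]
  have ev0: "eventually (\<lambda>z. norm (G 0 z - E z) \<le> \<epsilon>' * norm (E z)) (at 0 within {z. \<bar>Arg z\<bar> \<le> \<Delta>})" .
  have "eventually (\<lambda>z. norm (G h z) \<le> \<epsilon>' * norm (E z)) (at 0 within {z. \<bar>Arg z\<bar> \<le> \<Delta>})"
    if "h \<in> {1..<m}" for h
    using landau_o.smallD[OF landau_o.small_big_trans[OF minor asymp_equiv_imp_bigo[OF major]] \<epsilon>'(1), of h] that
    by (simp add: G_def)
  then have ev1: "eventually (\<lambda>z. \<forall>h\<in>{1..<m}. norm (G h z) \<le> \<epsilon>' * norm (E z)) (at 0 within {z. \<bar>Arg z\<bar> \<le> \<Delta>})"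
    by (intro eventually_ball_finite) auto
  \<comment> \<open>Since \<open>Arg 0 = 0\<close>, the origin belongs to the sector and must be
    excluded to obtain Re z > 0.\<close>
  have "eventually (\<lambda>z. z \<in> {z. \<bar>Arg z\<bar> \<le> \<Delta>} \<and> z \<noteq> 0) (at 0 within {z. \<bar>Arg z\<bar> \<le> \<Delta>})"
    by (auto simp: eventually_at intro: exI[of _ 1])
  with ev0 ev1 show ?thesis
  proof eventually_elim
    case (elim z)
    have "Re z > 0" using elim(3) \<Delta> Arg_Re_pos[of z] by auto
    show ?case
    proof
      fix N
      have "{..<m} = insert 0 {1..<m}" using m_pos by auto
      then have "residue_series c m N z - E z = (G 0 z - E z) + (\<Sum>h\<in>{1..<m}. cis (- 2 * pi * h * N / m) * G h z)"
        unfolding residue_series_eq[OF \<open>Re z > 0\<close>] G_def[symmetric] by simp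
      also have "norm \<dots> \<le> norm (G 0 z - E z) + (\<Sum>h\<in>{1..<m}. norm (cis (- 2 * pi * h * N / m) * G h z))"
        by (intro norm_triangle_mono order_refl norm_sum)
      also have "\<dots> \<le> \<epsilon>' * norm (E z) + (\<Sum>h\<in>{1..<m}. \<epsilon>' * norm (E z))"
        using elim by (intro add_mono sum_mono) (auto simp: norm_mult)
      also have "\<dots> = \<epsilon> * norm (E z)"
        using m_pos by (simp add: \<epsilon>'(2)[symmetric] of_nat_diff algebra_simps)
      finally show "norm (residue_series c m N z - E z) \<le> \<epsilon> * norm (E z)" .
    qed
  qed
qed

end

text \<open>The bridge between f and the masses: at z = x (1 - i s) the n-th term has phase e^(i s n
  x), which the factor e^(-i s N x) recentres at N, and the triangle integrates this to the Fejer
  kernel at (n - N) x. Sum and integral may be exchanged because the norms of the terms are a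
  summable sequence times one integrable function of s.\<close>

lemma tri_integral_dirichlet_series:
  fixes a :: "nat \<Rightarrow> real" and x t N :: real
  assumes a: "\<And>n. a n \<ge> 0" and summable_a: "summable (\<lambda>n. a n * exp (- real n * x))"
  shows "(CLINT s|lborel. tri (s - t) *\<^sub>R (iexp (- s * (N * x)) *
      (\<Sum>n. of_real (a n) * exp (- of_nat n * (of_real x * (1 - \<i> * of_real s)))))) =
    (\<Sum>n. of_real (a n * exp (- real n * x) * fejer ((real n - N) * x)) * iexp (t * ((real n - N) * x)))"
proof -
  define g where "g n s = of_real (a n * exp (- real n * x)) * (tri (s - t) *\<^sub>R iexp (s * ((real n - N) * x)))" for n s
  have g: "has_bochner_integral lborel (g n) (of_real (a n * exp (- real n * x)) * (iexp (t * ((real n - N) * x)) * fejer ((real n - N) * x)))" for n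
    unfolding g_def[abs_def] by (intro has_bochner_integral_mult_right has_bochner_integral_tri_shift_iexp)
  have norm_g: "norm (g n s) = a n * exp (- real n * x) * tri (s - t)" for n s
    using a[of n] by (simp add: g_def norm_mult)
  have g_eq: "tri (s - t) *\<^sub>R (iexp (- s * (N * x)) *
      (\<Sum>n. of_real (a n) * exp (- of_nat n * (of_real x * (1 - \<i> * of_real s))))) = (\<Sum>n. g n s)" for s
  proof -
    have "summable (\<lambda>n. norm (complex_of_real (a n) * exp (- of_nat n * (of_real x * (1 - \<i> * of_real s)))))"
      using summable_a a by (simp add: norm_mult norm_exp_eq_Re)
    then have sm: "summable (\<lambda>n. complex_of_real (a n) * exp (- of_nat n * (of_real x * (1 - \<i> * of_real s))))"
      by (rule summable_norm_cancel)
    have "tri (s - t) *\<^sub>R (iexp (- s * (N * x)) *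
      (\<Sum>n. of_real (a n) * exp (- of_nat n * (of_real x * (1 - \<i> * of_real s))))) =
      (\<Sum>n. (tri (s - t) *\<^sub>R iexp (- s * (N * x))) * (of_real (a n) * exp (- of_nat n * (of_real x * (1 - \<i> * of_real s)))))"
      by (subst suminf_mult[OF sm]) simp
    also have "(\<lambda>n. (tri (s - t) *\<^sub>R iexp (- s * (N * x))) * (of_real (a n) * exp (- of_nat n * (of_real x * (1 - \<i> * of_real s))))) = (\<lambda>n. g n s)"
    proof
      fix n
      have *: "exp (- of_nat n * (of_real x * (1 - \<i> * of_real s))) * iexp (- s * (N * x)) =
        of_real (exp (- real n * x)) * iexp (s * ((real n - N) * x))"
        unfolding exp_of_real[symmetric] exp_add[symmetric] by (simp add: algebra_simps)
      have "(tri (s - t) *\<^sub>R iexp (- s * (N * x))) * (of_real (a n) * exp (- of_nat n * (of_real x * (1 - \<i> * of_real s)))) =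
        of_real (a n) * of_real (tri (s - t)) * (exp (- of_nat n * (of_real x * (1 - \<i> * of_real s))) * iexp (- s * (N * x)))"
        by (simp only: scaleR_conv_of_real mult_ac)
      also have "\<dots> = g n s"
        unfolding * by (simp only: g_def of_real_mult scaleR_conv_of_real mult_ac)
      finally show "(tri (s - t) *\<^sub>R iexp (- s * (N * x))) * (of_real (a n) * exp (- of_nat n * (of_real x * (1 - \<i> * of_real s)))) = g n s" .
    qed
    finally show ?thesis .
  qed
  have tri_int: "integrable lborel (\<lambda>s. tri (s - t))"
    using lborel_integrable_real_affine[OF integrable_tri, of 1 "- t"] by (simp add: add.commute)
  have "(CLINT s|lborel. (\<Sum>n. g n s)) = (\<Sum>n. integral\<^sup>L lborel (g n))"
  proof (rule integral_suminf)
    show "integrable lborel (g n)" for n using g by (simp add: has_bochner_integral_iff)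
    show "AE s in lborel. summable (\<lambda>n. norm (g n s))"
      unfolding norm_g by (rule AE_I2, rule summable_mult2, rule summable_a)
    show "summable (\<lambda>n. LINT s|lborel. norm (g n s))"
      unfolding norm_g integral_mult_right_zero by (rule summable_mult2, rule summable_a)
  qed
  then show ?thesis
    unfolding g_eq using g by (simp add: has_bochner_integral_iff mult_ac)
qed

section \<open>Monotonicity on short windows\<close>

text \<open>At fixed \<delta> the limits in N confine B asymptotically between l (1 - e^(-\<delta>))
  / \<delta> and l (e^\<delta> - 1) / \<delta>, and both quotients tend to l as \<delta> -> 0. The
  term \<open>y\<close> allows for a counting error, which disappears with N before \<delta> is made
  small.\<close>

lemma tendsto_window_squeeze:
  fixes B y :: "nat \<Rightarrow> real" and U V :: "real \<Rightarrow> nat \<Rightarrow> real"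
  assumes "l > 0" and y: "y \<longlonglongrightarrow> 0"
    and U: "\<And>\<delta>. 0 < \<delta> \<Longrightarrow> \<delta> \<le> 1 \<Longrightarrow> U \<delta> \<longlonglongrightarrow> l * (exp \<delta> - 1)"
    and V: "\<And>\<delta>. 0 < \<delta> \<Longrightarrow> \<delta> \<le> 1 \<Longrightarrow> V \<delta> \<longlonglongrightarrow> l * (1 - exp (- \<delta>))"
    and upper: "\<And>\<delta>. 0 < \<delta> \<Longrightarrow> \<delta> \<le> 1 \<Longrightarrow> eventually (\<lambda>N. \<delta> * B N \<le> U \<delta> N) sequentially"
    and lower: "\<And>\<delta>. 0 < \<delta> \<Longrightarrow> \<delta> \<le> 1 \<Longrightarrow> eventually (\<lambda>N. V \<delta> N \<le> (\<delta> + y N) * B N) sequentially"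
  shows "B \<longlonglongrightarrow> l"
proof -
  have small: "eventually (\<lambda>\<delta>. 0 < \<delta> \<and> \<delta> \<le> (1::real)) (at_right 0)"
    by (auto simp: eventually_at_right_field intro: exI[of _ 1])
  show ?thesis
  proof (rule order_tendstoI)
    fix a assume "a < l"
    have "((\<lambda>\<delta>. l * (1 - exp (- \<delta>)) / \<delta>) \<longlongrightarrow> l) (at_right 0)"
      by real_asymp
    from eventually_conj[OF order_tendstoD(1)[OF this \<open>a < l\<close>] small] obtain \<delta>
      where \<delta>: "a < l * (1 - exp (- \<delta>)) / \<delta>" "0 < \<delta>" "\<delta> \<le> 1"
      using eventually_happens'[OF trivial_limit_at_right_real] by blast
    have "(\<lambda>N. V \<delta> N / (\<delta> + y N)) \<longlonglongrightarrow> l * (1 - exp (- \<delta>)) / (\<delta> + 0)"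
      using \<delta> by (intro tendsto_intros V y) auto
    then have "eventually (\<lambda>N. a < V \<delta> N / (\<delta> + y N)) sequentially"
      using \<delta> by (intro order_tendstoD(1)) auto
    moreover have "eventually (\<lambda>N. y N > - \<delta>) sequentially"
      using \<delta> by (intro order_tendstoD(1)[OF y]) auto
    ultimately show "eventually (\<lambda>N. a < B N) sequentially"
      using lower[OF \<delta>(2,3)]
    proof eventually_elim
      case (elim N)
      then have "V \<delta> N / (\<delta> + y N) \<le> B N" by (simp add: divide_le_eq mult.commute)
      with elim show ?case by linarith
    qed
  next
    fix a assume "l < a"
    have "((\<lambda>\<delta>. l * (exp \<delta> - 1) / \<delta>) \<longlongrightarrow> l) (at_right 0)"
      by real_asymp
    from eventually_conj[OF order_tendstoD(2)[OF this \<open>l < a\<close>] small] obtain \<delta>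
      where \<delta>: "l * (exp \<delta> - 1) / \<delta> < a" "0 < \<delta>" "\<delta> \<le> 1"
      using eventually_happens'[OF trivial_limit_at_right_real] by blast
    have "(\<lambda>N. U \<delta> N / \<delta>) \<longlonglongrightarrow> l * (exp \<delta> - 1) / \<delta>"
      using \<delta> by (intro tendsto_intros U) auto
    then have "eventually (\<lambda>N. U \<delta> N / \<delta> < a) sequentially"
      using \<delta> by (intro order_tendstoD(2)) auto
    with upper[OF \<delta>(2,3)] show "eventually (\<lambda>N. B N < a) sequentially"
    proof eventually_elim
      case (elim N)
      then have "B N \<le> U \<delta> N / \<delta>" using \<delta> by (simp add: le_divide_eq mult.commute)
      with elim show ?case by linarith
    qed
  qed
qed

lemma mono_residue_class:
  fixes c :: "nat \<Rightarrow> real"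
  assumes "\<And>n. c (n + m) \<ge> c n"
  shows "c n \<le> c (n + j * m)"
proof (induction j)
  case (Suc j)
  with assms[of "n + j * m"] show ?case by (simp add: algebra_simps)
qed simp

definition window_sum :: "(nat \<Rightarrow> real) \<Rightarrow> nat \<Rightarrow> nat \<Rightarrow> real \<Rightarrow> real \<Rightarrow> real \<Rightarrow> real" where
  "window_sum c m N x p q = (\<Sum>n. if (real n - real N) * x \<in> {p..q} \<and> n mod m = N mod m then real m * c n else 0)"

lemma finite_window:
  assumes "x > 0"
  shows "finite {n. (real n - real N) * x \<le> q}"
proof (rule finite_subset)
  show "{n. (real n - real N) * x \<le> q} \<subseteq> {..nat \<lceil>N + q / x\<rceil>}"
  proof
    fix n assume "n \<in> {n. (real n - real N) * x \<le> q}"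
    then have "real n \<le> N + q / x"
      using assms by (simp add: field_simps)
    then show "n \<in> {..nat \<lceil>N + q / x\<rceil>}"
      by (simp add: le_nat_iff) linarith
  qed
qed simp

lemma window_sum_eq:
  assumes "x > 0"
  shows "window_sum c m N x p q =
    (\<Sum>n | (real n - real N) * x \<in> {p..q} \<and> n mod m = N mod m. real m * c n)"
    "finite {n. (real n - real N) * x \<in> {p..q} \<and> n mod m = N mod m}"
proof -
  show *: "finite {n. (real n - real N) * x \<in> {p..q} \<and> n mod m = N mod m}"
    by (rule finite_subset[OF _ finite_window[OF assms, of N q]]) auto
  show "window_sum c m N x p q =
    (\<Sum>n | (real n - real N) * x \<in> {p..q} \<and> n mod m = N mod m. real m * c n)"
    unfolding window_sum_def by (subst suminf_finite[OF *]) (auto intro!: sum.cong)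
qed

context
  fixes c :: "nat \<Rightarrow> real" and m :: nat
  assumes nonneg: "\<And>n. c n \<ge> 0" and m_pos: "m > 0" and mono_step: "\<And>n. c (n + m) \<ge> c n"
begin

text \<open>The class of N meets the window in at least J + 1 points, N included, each with
  coefficient at least c N. As J + 1 >= \<delta> / (m x), the weight m cancels the spacing and no
  error term is left.\<close>

lemma window_sum_ge:
  assumes "x > 0" "\<delta> \<ge> 0"
  shows "\<delta> / x * c N \<le> window_sum c m N x 0 \<delta>"
proof -
  define J where "J = nat \<lfloor>\<delta> / (m * x)\<rfloor>"
  have J: "\<delta> / (m * x) \<le> real (J + 1)" "real J \<le> \<delta> / (m * x)"
    using assms by (auto simp: J_def of_nat_nat) linarith
  have "\<delta> / x = m * (\<delta> / (m * x))" using m_pos by simp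
  also have "\<dots> \<le> m * real (J + 1)"
    by (intro mult_left_mono J) auto
  finally have "\<delta> / x * c N \<le> m * real (J + 1) * c N"
    using nonneg by (intro mult_right_mono)
  also have "\<dots> = (\<Sum>j\<in>{..J}. m * c N)" by simp
  also have "\<dots> \<le> (\<Sum>j\<in>{..J}. m * c (N + j * m))"
    by (intro sum_mono mult_left_mono mono_residue_class mono_step) auto
  also have "\<dots> = (\<Sum>n\<in>(\<lambda>j. N + j * m) ` {..J}. m * c n)"
    using m_pos by (subst sum.reindex) (auto simp: inj_on_def)
  also have "\<dots> \<le> window_sum c m N x 0 \<delta>"
    unfolding window_sum_eq(1)[OF assms(1)]
  proof (rule sum_mono2[OF window_sum_eq(2)[OF assms(1)]])
    show "(\<lambda>j. N + j * m) ` {..J} \<subseteq> {n. (real n - real N) * x \<in> {0..\<delta>} \<and> n mod m = N mod m}"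
    proof clarify
      fix j assume "j \<le> J"
      then have "real j * (m * x) \<le> \<delta> / (m * x) * (m * x)"
        using assms J(2) by (intro mult_right_mono) auto
      then show "(real (N + j * m) - real N) * x \<in> {0..\<delta>} \<and> (N + j * m) mod m = N mod m"
        using assms m_pos by (simp add: mult_ac)
    qed
  qed (use nonneg in auto)
  finally show ?thesis .
qed

text \<open>To the left of N the coefficients are at most c N, but now the J + 1 points must be
  bounded from above, by \<delta> / (m x) + 1. The extra point, weighted by m, is the summand
  \<open>m\<close>.\<close>

lemma window_sum_le:
  assumes "x > 0" "\<delta> \<ge> 0"
  shows "window_sum c m N x (- \<delta>) 0 \<le> (\<delta> / x + m) * c N"
proof -
  define J where "J = nat \<lfloor>\<delta> / (m * x)\<rfloor>"
  have J: "real J \<le> \<delta> / (m * x)"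
    using assms by (auto simp: J_def of_nat_nat)
  define A where "A = {n. (real n - real N) * x \<in> {- \<delta>..0} \<and> n mod m = N mod m}"
  have A: "\<exists>j\<le>J. N = n + j * m" if "n \<in> A" for n
  proof -
    from that have n: "(real N - real n) * x \<le> \<delta>" "real n \<le> real N" "n mod m = N mod m"
      using assms by (auto simp: A_def mult_le_0_iff algebra_simps)
    then have "n \<le> N" by simp
    then have "m dvd N - n" using n(3) by (metis mod_eq_dvd_iff_nat)
    then obtain j where "N - n = m * j" by (auto simp: dvd_def)
    with \<open>n \<le> N\<close> have j: "N = n + j * m" by (simp add: mult.commute)
    with n(1) have "real j * (m * x) \<le> \<delta>" by (simp add: mult_ac)
    then have "real j \<le> \<delta> / (m * x)" using assms m_pos by (simp add: le_divide_eq)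
    then have "j \<le> J" unfolding J_def by (simp add: le_nat_floor)
    with j show ?thesis by blast
  qed
  \<comment> \<open>An inclusion suffices for the cardinality bound, so values where the natural
    subtraction truncates to 0 do no harm.\<close>
  have "A \<subseteq> (\<lambda>j. N - j * m) ` {..J}"
  proof
    fix n assume "n \<in> A"
    from A[OF this] obtain j where "j \<le> J" "N = n + j * m" by blast
    then show "n \<in> (\<lambda>j. N - j * m) ` {..J}" by (intro image_eqI[of _ _ j]) auto
  qed
  then have "card A \<le> card {..J}" by (rule surj_card_le[rotated]) simp
  then have card: "real (card A) \<le> J + 1" by simp
  have "window_sum c m N x (- \<delta>) 0 = (\<Sum>n\<in>A. m * c n)"
    unfolding window_sum_eq(1)[OF assms(1)] A_def ..
  also have "\<dots> \<le> (\<Sum>n\<in>A. m * c N)"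
  proof (intro sum_mono mult_left_mono)
    fix n assume "n \<in> A"
    with A mono_residue_class[of c m, OF mono_step] show "c n \<le> c N" by blast
  qed simp
  also have "\<dots> = real (card A) * (m * c N)" by simp
  also have "\<dots> \<le> (\<delta> / (m * x) + 1) * (m * c N)"
    using card J nonneg by (intro mult_right_mono) auto
  also have "\<dots> = (\<delta> / x + m) * c N" using m_pos by (simp add: field_simps)
  finally show ?thesis .
qed

end

section \<open>The asymptotic formula\<close>

text \<open>The point at which exp (N x) times the growth function is stationary in x, up to the
  contribution of the power of x.\<close>

definition saddle :: "real \<Rightarrow> real \<Rightarrow> nat \<Rightarrow> real" where
  "saddle \<beta> \<rho> N = (\<beta> / N) powr (1 / (1 + \<rho>))"

lemma saddle_pos: "\<beta> > 0 \<Longrightarrow> N > 0 \<Longrightarrow> saddle \<beta> \<rho> N > 0"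
  by (simp add: saddle_def)

lemma saddle_eq:
  assumes "\<beta> > 0" "\<rho> > 0" "N > 0"
  shows "N * saddle \<beta> \<rho> N = \<beta> * saddle \<beta> \<rho> N powr (- \<rho>)"
proof -
  define x where "x = saddle \<beta> \<rho> N"
  have x: "x > 0" using assms by (simp add: x_def saddle_pos)
  have "x * x powr \<rho> = x powr (1 + \<rho>)" using x by (simp add: powr_add)
  also have "\<dots> = \<beta> / N" using assms by (simp add: x_def saddle_def powr_powr)
  finally show ?thesis
    using x assms unfolding x_def[symmetric] by (simp add: powr_minus field_simps)
qed

lemma filterlim_saddle:
  assumes "\<beta> > 0" "\<rho> > 0"
  shows "filterlim (saddle \<beta> \<rho>) (at_right 0) sequentially"
  unfolding saddle_def[abs_def] using assms by real_asymp

text \<open>Restates the target in terms of the saddle point. In the logarithms of x, \<beta> and N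
  the saddle equation is linear, (1 + \<rho>) X = b - n, so the identities between powers become
  linear identities between exponents.\<close>

lemma asymptotic_formula_eq:
  assumes "\<beta> > 0" "\<rho> > 0" "N > 0"
  defines "x \<equiv> saddle \<beta> \<rho> N"
  shows "\<alpha> * \<beta> powr ((1 + 2 * \<gamma>) / (2 * (1 + \<rho>))) / sqrt (2 * pi * (1 + \<rho>)) *
      real N powr (- ((1 + 2 * \<gamma>) / (2 * (1 + \<rho>))) - 1 / 2) *
      exp ((1 + 1 / \<rho>) * \<beta> powr (1 / (1 + \<rho>)) * real N powr (\<rho> / (1 + \<rho>))) =
    1 / sqrt (2 * pi * (1 + \<rho>)) * (x * rgrowth \<alpha> \<beta> \<gamma> \<rho> x * exp (N * x) / sqrt (N * x))"
proof -
  have x: "x > 0" unfolding x_def by (rule saddle_pos) (use assms in auto)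
  define X where "X = ln x"
  define b where "b = ln \<beta>"
  define n where "n = ln (real N)"
  have X: "X = (b - n) / (1 + \<rho>)"
    using assms by (simp add: X_def x_def saddle_def b_def n_def ln_powr ln_div)
  have x_eq: "x = exp X" using x by (simp add: X_def)
  have N_eq: "real N = exp n" using assms by (simp add: n_def)
  have \<beta>_eq: "\<beta> = exp b" using assms by (simp add: b_def)
  have \<rho>: "1 + \<rho> \<noteq> 0" "\<rho> \<noteq> 0" using assms by auto
  have Nx: "\<beta> powr (1 / (1 + \<rho>)) * real N powr (\<rho> / (1 + \<rho>)) = N * x"
  proof -
    have "b * (1 / (1 + \<rho>)) + n * (\<rho> / (1 + \<rho>)) = n + X"
    proof -
      have "(1 + \<rho>) * X = b - n" using \<rho> by (simp add: X)
      then have "b + n * \<rho> = (n + X) * (1 + \<rho>)" by (simp add: algebra_simps)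
      then have "(b + n * \<rho>) / (1 + \<rho>) = n + X" using \<rho> by simp
      then show ?thesis by (simp add: add_divide_distrib)
    qed
    then show ?thesis
      unfolding N_eq x_eq \<beta>_eq by (simp add: powr_def mult_ac flip: exp_add)
  qed
  have A: "\<beta> powr ((1 + 2 * \<gamma>) / (2 * (1 + \<rho>))) * real N powr (- ((1 + 2 * \<gamma>) / (2 * (1 + \<rho>))) - 1 / 2) =
      x * x powr \<gamma> / sqrt (N * x)"
  proof -
    have "(1 + 2 * \<gamma>) / (2 * (1 + \<rho>)) * b + (- ((1 + 2 * \<gamma>) / (2 * (1 + \<rho>))) - 1 / 2) * n
        = (1 + 2 * \<gamma>) / 2 * X - n / 2"
    proof -
      define A where "A = (1 + 2 * \<gamma>) / (2 * (1 + \<rho>))"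
      have "A = (1 + 2 * \<gamma>) / 2 / (1 + \<rho>)"
        by (simp only: A_def divide_divide_eq_left)
      then have "A * (1 + \<rho>) = (1 + 2 * \<gamma>) / 2"
        using \<rho>(1) by (simp only: nonzero_eq_divide_eq not_False_eq_True)
      moreover have "(1 + \<rho>) * X = b - n" using \<rho> by (simp add: X)
      moreover have "A * b + (- A - 1 / 2) * n = A * (b - n) - n / 2" by (simp add: algebra_simps)
      ultimately show ?thesis
        unfolding A_def[symmetric] by (metis mult.assoc)
    qed
    also have "\<dots> = X + \<gamma> * X - (n + X) / 2" by (simp add: field_simps)
    finally have "exp ((1 + 2 * \<gamma>) / (2 * (1 + \<rho>)) * b + (- ((1 + 2 * \<gamma>) / (2 * (1 + \<rho>))) - 1 / 2) * n)
       = exp X * exp (\<gamma> * X) / exp ((n + X) / 2)"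
      by (simp only: exp_diff exp_add)
    moreover have "exp ((n + X) / 2) = sqrt (N * x)"
      unfolding N_eq x_eq exp_add[symmetric] by (rule real_sqrt_unique[symmetric]) (simp_all flip: exp_of_nat_mult)
    moreover have "exp (\<gamma> * X) = x powr \<gamma>" using x by (simp add: powr_def X_def)
    moreover have "exp ((1 + 2 * \<gamma>) / (2 * (1 + \<rho>)) * b) = \<beta> powr ((1 + 2 * \<gamma>) / (2 * (1 + \<rho>)))"
      using assms by (simp only: powr_def b_def) simp
    moreover have "exp ((- ((1 + 2 * \<gamma>) / (2 * (1 + \<rho>))) - 1 / 2) * n) = real N powr (- ((1 + 2 * \<gamma>) / (2 * (1 + \<rho>))) - 1 / 2)"
      using assms by (simp only: powr_def n_def) simp
    ultimately show ?thesis
      by (simp only: exp_add x_eq[symmetric])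
  qed
  have E1: "(1 + 1 / \<rho>) * \<beta> powr (1 / (1 + \<rho>)) * real N powr (\<rho> / (1 + \<rho>)) = N * x + N * x / \<rho>"
    unfolding mult.assoc Nx using \<rho> by (simp add: field_simps)
  have E2: "\<beta> * x powr (- \<rho>) / \<rho> = N * x / \<rho>"
    using saddle_eq[of \<beta> \<rho> N] assms by simp
  show ?thesis
    unfolding rgrowth_def E1 E2
    using arg_cong[OF A, of "\<lambda>u. \<alpha> / sqrt (2 * pi * (1 + \<rho>)) * u * exp (N * x + N * x / \<rho>)"]
    by (simp add: exp_add mult_ac)
qed

theorem theorem1p4:
  fixes c :: "nat \<Rightarrow> real" and f :: "complex \<Rightarrow> complex" and m :: nat
    and \<alpha> \<beta> \<gamma> \<rho> :: real
  assumes power_series: "\<And>q. norm q < 1 \<Longrightarrow> (\<lambda>n. complex_of_real (c n) * q ^ n) sums f q"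
    and nonneg: "\<And>n. c n \<ge> 0"
    and m_pos: "m > 0"
    and mono_step: "\<And>n. c (n + m) \<ge> c n"
    and consts_pos: "\<alpha> > 0" "\<beta> > 0" "\<rho> > 0"
    and major: "\<And>\<Delta>. 0 < \<Delta> \<Longrightarrow> \<Delta> < pi / 2 \<Longrightarrow>
      (\<lambda>z. f (exp (- z))) \<sim>[at 0 within {z. \<bar>Arg z\<bar> \<le> \<Delta>}]
        (\<lambda>z. complex_of_real \<alpha> * z powr complex_of_real \<gamma> *
          exp (complex_of_real \<beta> * z powr complex_of_real (- \<rho>) / complex_of_real \<rho>))"
    and minor: "\<And>h \<Delta>. 1 \<le> h \<Longrightarrow> h < m \<Longrightarrow> 0 < \<Delta> \<Longrightarrow> \<Delta> < pi / 2 \<Longrightarrow>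
      (\<lambda>z. f (exp (- z) * exp (2 * complex_of_real pi * \<i> * of_nat h / of_nat m)))
        \<in> o[at 0 within {z. \<bar>Arg z\<bar> \<le> \<Delta>}](\<lambda>z. f (exp (- z)))"
  shows "c \<sim>[at_top]
    (\<lambda>n. \<alpha> * \<beta> powr ((1 + 2 * \<gamma>) / (2 * (1 + \<rho>))) / sqrt (2 * pi * (1 + \<rho>)) *
      real n powr (- ((1 + 2 * \<gamma>) / (2 * (1 + \<rho>))) - 1 / 2) *
      exp ((1 + 1 / \<rho>) * \<beta> powr (1 / (1 + \<rho>)) * real n powr (\<rho> / (1 + \<rho>))))"
proof -
  define x where "x = saddle \<beta> \<rho>"
  define \<Lambda> where "\<Lambda> N = real N * x N" for N
  define e where "e N = rgrowth \<alpha> \<beta> \<gamma> \<rho> (x N)" for N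
  define L where "L = sqrt (2 * pi / (1 + \<rho>))"
  have "L > 0" using consts_pos by (simp add: L_def)
  define a where "a N n = (if n mod m = N mod m then real m * c n else 0)" for N n
  have a_nonneg: "a N n \<ge> 0" for N n using nonneg by (simp add: a_def)
  have x_lim: "filterlim x (at_right 0) sequentially"
    unfolding x_def using consts_pos by (intro filterlim_saddle)
  have x_nonneg: "x N \<ge> 0" for N by (simp add: x_def saddle_def)
  have x_pos: "x N > 0" if "N > 0" for N
    using that consts_pos by (simp add: x_def saddle_pos)
  have e_pos: "e N > 0" if "N > 0" for N
    using x_pos[OF that] consts_pos by (simp add: e_def rgrowth_def)
  \<comment> \<open>For N = 0 the saddle point is (\<beta> / 0) powr ... = 0, and neither its
    positivity nor the saddle equation is available.\<close>
  have ev_pos: "eventually (\<lambda>N::nat. N > 0) sequentially"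
    by (rule eventually_gt_at_top)
  have \<Lambda>_eq: "eventually (\<lambda>N. \<Lambda> N = \<beta> * x N powr (- \<rho>)) sequentially"
    using ev_pos by eventually_elim (use consts_pos in \<open>simp add: \<Lambda>_def x_def saddle_eq\<close>)
  have summable_a: "summable (\<lambda>n. a N n * exp (- real n * y))" if "y > 0" for N y
  proof (rule summable_comparison_test')
    have "summable (\<lambda>n. complex_of_real (c n) * of_real (exp (- y)) ^ n)"
      using power_series[of "of_real (exp (- y))"] that by (simp add: sums_iff)
    then have "summable (\<lambda>n. complex_of_real (c n * exp (- y) ^ n))" by simp
    then have "summable (\<lambda>n. c n * exp (- y) ^ n)" by (simp only: summable_of_real_iff)
    then show "summable (\<lambda>n. real m * (c n * exp (- y) ^ n))" by (rule summable_mult)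
    show "norm (a N n * exp (- real n * y)) \<le> real m * (c n * exp (- y) ^ n)" for n
      using nonneg[of n] by (simp add: a_def flip: exp_of_nat_mult)
  qed

  \<comment> \<open>Dividing by \<open>e N\<close> normalises the total mass; the factor sqrt
    \<Lambda> compensates for spreading that mass over a width of order sqrt \<Lambda> in the
    variable \<open>v\<close>.\<close>
  define b where "b N n = sqrt (\<Lambda> N) / e N * (a N n * exp (- real n * x N))" for N n
  define v where "v N n = (real n - real N) * x N" for N n
  have b_nonneg: "b N n \<ge> 0" for N n
    using consts_pos a_nonneg x_nonneg[of N]
    by (auto simp: b_def e_def rgrowth_def \<Lambda>_def intro!: mult_nonneg_nonneg divide_nonneg_nonneg)
  have b_summable: "summable (b N)" if "N > 0" for N
    unfolding b_def by (intro summable_mult summable_a x_pos that)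
  have b_fejer: "summable (\<lambda>n. b N n * fejer (v N n))" if "N > 0" for N
  proof (rule summable_comparison_test'[OF b_summable[OF that]])
    show "norm (b N n * fejer (v N n)) \<le> b N n" for n
      using b_nonneg fejer_le_1 by (simp add: abs_mult mult_left_le)
  qed
  have lim: "(\<lambda>N. \<Sum>n. of_real (b N n * fejer (v N n)) * iexp (t * v N n)) \<longlonglongrightarrow> of_real (L * tri t)" for t
  proof -
    have "(\<lambda>N. of_real (sqrt (\<Lambda> N) / rgrowth \<alpha> \<beta> \<gamma> \<rho> (x N)) *
      (CLINT s|lborel. tri (s - t) *\<^sub>R (iexp (- s * \<Lambda> N) * residue_series c m N (of_real (x N) * (1 - \<i> * of_real s)))))
      \<longlonglongrightarrow> of_real (sqrt (2 * pi / (1 + \<rho>)) * tri t)"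
    proof (rule saddle_point_tendsto[OF consts_pos _ _ x_lim \<Lambda>_eq])
      show "eventually (\<lambda>z. \<forall>N. norm (residue_series c m N z - growth \<alpha> \<beta> \<gamma> \<rho> z) \<le> \<epsilon> * norm (growth \<alpha> \<beta> \<gamma> \<rho> z))
        (at 0 within {z. \<bar>Arg z\<bar> \<le> \<Delta>})" if "0 < \<Delta>" "\<Delta> < pi / 2" "\<epsilon> > 0" for \<Delta> \<epsilon>
        by (rule residue_series_approx[OF power_series m_pos that])
          (use major[OF that(1,2)] minor that in \<open>auto simp: growth_def[abs_def]\<close>)
      show "(\<lambda>s. residue_series c m N (of_real (x N) * (1 - \<i> * of_real s))) \<in> borel_measurable borel" for N
        unfolding residue_series_def by measurable
    qed
    moreover have "eventually (\<lambda>N. of_real (sqrt (\<Lambda> N) / rgrowth \<alpha> \<beta> \<gamma> \<rho> (x N)) *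
      (CLINT s|lborel. tri (s - t) *\<^sub>R (iexp (- s * \<Lambda> N) * residue_series c m N (of_real (x N) * (1 - \<i> * of_real s))))
      = (\<Sum>n. of_real (b N n * fejer (v N n)) * iexp (t * v N n))) sequentially"
      using ev_pos
    proof eventually_elim
      case (elim N)
      have "summable (\<lambda>n. norm (of_real (a N n * exp (- real n * x N) * fejer (v N n)) * iexp (t * v N n)))"
      proof (rule summable_comparison_test'[OF summable_a[OF x_pos[OF elim]]])
        show "norm (norm (of_real (a N n * exp (- real n * x N) * fejer (v N n)) * iexp (t * v N n)))
           \<le> a N n * exp (- real n * x N)" for n
          using a_nonneg[of N n] fejer_le_1 by (simp add: norm_mult abs_mult mult_left_le)
      qed
      then have sm: "summable (\<lambda>n. of_real (a N n * exp (- real n * x N) * fejer (v N n)) * iexp (t * v N n))"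
        by (rule summable_norm_cancel)
      show ?case
        unfolding residue_series_def a_def[symmetric] \<Lambda>_def
        unfolding tri_integral_dirichlet_series[OF a_nonneg summable_a[OF x_pos[OF elim]]]
        unfolding \<Lambda>_def[symmetric] v_def[symmetric] e_def[symmetric]
        by (subst suminf_mult[OF sm, symmetric]) (simp add: b_def mult_ac)
    qed
    ultimately show ?thesis
      unfolding L_def by (rule Lim_transform_eventually)
  qed
  \<comment> \<open>Since e^(-nx) = e^(-\<Lambda>) e^(-v), multiplying the masses by e^v leaves the
    coefficients themselves, times a factor independent of n.\<close>
  define k where "k N = sqrt (\<Lambda> N) * exp (- \<Lambda> N) / e N" for N
  have k_nonneg: "k N \<ge> 0" for N
    using consts_pos x_nonneg[of N] by (auto simp: k_def e_def rgrowth_def \<Lambda>_def)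
  have window: "(\<lambda>N. k N * window_sum c m N (x N) p q) \<longlonglongrightarrow> L / (2 * pi) * (exp q - exp p)"
    if "-1 \<le> p" "p \<le> q" "q \<le> 1" for p q
  proof -
    have "eventually (\<lambda>N. summable (\<lambda>n. b N n * fejer (v N n))) sequentially"
      using ev_pos by eventually_elim (rule b_fejer)
    from tendsto_window_sum[OF b_nonneg this lim \<open>L > 0\<close> that]
    have "(\<lambda>N. \<Sum>n. if v N n \<in> {p..q} then b N n * exp (v N n) else 0) \<longlonglongrightarrow> L / (2 * pi) * (exp q - exp p)" .
    moreover have "eventually (\<lambda>N. (\<Sum>n. if v N n \<in> {p..q} then b N n * exp (v N n) else 0) = k N * window_sum c m N (x N) p q) sequentially"
      using ev_pos
    proof eventually_elim
      case (elim N)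
      have "(if v N n \<in> {p..q} then b N n * exp (v N n) else 0) =
        k N * (if (real n - real N) * x N \<in> {p..q} \<and> n mod m = N mod m then real m * c n else 0)" for n
      proof -
        have "exp (- real n * x N) * exp (v N n) = exp (- \<Lambda> N)"
          by (simp add: v_def \<Lambda>_def algebra_simps flip: exp_add)
        then have "b N n * exp (v N n) = k N * a N n"
          by (simp add: b_def k_def)
        then show ?thesis by (simp add: a_def v_def)
      qed
      moreover have "summable (\<lambda>n. if (real n - real N) * x N \<in> {p..q} \<and> n mod m = N mod m then real m * c n else 0)"
        by (rule summable_finite[OF window_sum_eq(2)[OF x_pos[OF elim]]]) auto
      ultimately show ?case
        unfolding window_sum_def by (simp only: suminf_mult)
    qed
    ultimately show ?thesis by (rule Lim_transform_eventually)
  qed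
  \<comment> \<open>The mass per unit of \<open>v\<close> at N: points of the class lie m x apart
    and carry weight m, so their density is c N / x.\<close>
  define B where "B N = k N * c N / x N" for N
  have "B \<longlonglongrightarrow> L / (2 * pi)"
  proof (rule tendsto_window_squeeze)
    show "L / (2 * pi) > 0" using \<open>L > 0\<close> by simp
    have "x \<longlonglongrightarrow> 0" using x_lim by (simp add: filterlim_at)
    \<comment> \<open>The single extra point of the left window, measured in the variable
      \<open>v\<close>.\<close>
    then show "(\<lambda>N. m * x N) \<longlonglongrightarrow> 0" by (rule tendsto_mult_right_zero)
    fix \<delta> :: real assume \<delta>: "0 < \<delta>" "\<delta> \<le> 1"
    show "(\<lambda>N. k N * window_sum c m N (x N) 0 \<delta>) \<longlonglongrightarrow> L / (2 * pi) * (exp \<delta> - 1)"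
      using window[of 0 \<delta>] \<delta> by simp
    show "(\<lambda>N. k N * window_sum c m N (x N) (- \<delta>) 0) \<longlonglongrightarrow> L / (2 * pi) * (1 - exp (- \<delta>))"
      using window[of "- \<delta>" 0] \<delta> by simp
    show "eventually (\<lambda>N. \<delta> * B N \<le> k N * window_sum c m N (x N) 0 \<delta>) sequentially"
      using ev_pos
    proof eventually_elim
      case (elim N)
      have "\<delta> * B N = k N * (\<delta> / x N * c N)" by (simp add: B_def)
      also have "\<dots> \<le> k N * window_sum c m N (x N) 0 \<delta>"
        using \<delta> x_pos[OF elim] by (intro mult_left_mono k_nonneg window_sum_ge nonneg m_pos mono_step) auto
      finally show ?case .
    qed
    show "eventually (\<lambda>N. k N * window_sum c m N (x N) (- \<delta>) 0 \<le> (\<delta> + m * x N) * B N) sequentially"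
      using ev_pos
    proof eventually_elim
      case (elim N)
      have "k N * window_sum c m N (x N) (- \<delta>) 0 \<le> k N * ((\<delta> / x N + m) * c N)"
        using \<delta> x_pos[OF elim] by (intro mult_left_mono k_nonneg window_sum_le nonneg m_pos mono_step) auto
      also have "\<dots> = (\<delta> + m * x N) * B N"
        using x_pos[OF elim] by (simp add: B_def field_simps)
      finally show ?case .
    qed
  qed
  then have "(\<lambda>N. B N * sqrt (2 * pi * (1 + \<rho>))) \<longlonglongrightarrow> L / (2 * pi) * sqrt (2 * pi * (1 + \<rho>))"
    by (intro tendsto_intros)
  moreover have "L / (2 * pi) * sqrt (2 * pi * (1 + \<rho>)) = 1"
  proof -
    have "L * sqrt (2 * pi * (1 + \<rho>)) = sqrt ((2 * pi)\<^sup>2)"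
      unfolding L_def real_sqrt_mult[symmetric] using consts_pos by (simp add: power2_eq_square)
    also have "\<dots> = 2 * pi" by (simp only: real_sqrt_abs) simp
    finally show ?thesis by simp
  qed
  ultimately have lim1: "(\<lambda>N. B N * sqrt (2 * pi * (1 + \<rho>))) \<longlonglongrightarrow> 1" by simp
  show ?thesis
  proof (rule asymp_equivI', rule Lim_transform_eventually[OF lim1])
    show "eventually (\<lambda>N. B N * sqrt (2 * pi * (1 + \<rho>)) = c N / (\<alpha> * \<beta> powr ((1 + 2 * \<gamma>) / (2 * (1 + \<rho>))) / sqrt (2 * pi * (1 + \<rho>)) *
      real N powr (- ((1 + 2 * \<gamma>) / (2 * (1 + \<rho>))) - 1 / 2) *
      exp ((1 + 1 / \<rho>) * \<beta> powr (1 / (1 + \<rho>)) * real N powr (\<rho> / (1 + \<rho>))))) sequentially"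
      using ev_pos
    proof eventually_elim
      case (elim N)
      show ?case
        unfolding asymptotic_formula_eq[OF consts_pos(2,3) elim] x_def[symmetric] e_def[symmetric] \<Lambda>_def[symmetric]
        using x_pos[OF elim] e_pos[OF elim] elim consts_pos
        by (simp add: B_def k_def exp_minus field_simps)
    qed
  qed
qed

end
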